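(* Let $M\in\mathbb{R}^{p\times p}$ be a rank-$r$ symmetric matrix and let $U\in\mathbb{O}_{p,r}$ consist of the eigenvectors of $M$ (corresponding to its nonzero eigenvalues). Let $Z\in\mathbb{R}^{p\times p}$ be symmetric and $N=M+Z$. Let $\widehat U^{(t)}=[u_1^{(t)}\cdots u_r^{(t)}]$ be the intermediate result of HeteroPCA with input matrix $N$ and rank $r$ after $t$ iterations. There exists a universal constant $c_I>0$ such that if $$\frac{I(U)\,\|M\|}{\lambda_r(M)}\le c_I\,\frac pr,$$ then $$\big\|\sin\Theta(\widehat U^{(t)},U)\big\|\le\frac{4\|\Delta(Z)\|}{\lambda_r(M)}+2^{-(t+3)}.$$ In particular, if $T=\Omega\big(\log\frac{\lambda_r(M)}{\|\Delta(Z)\|}\vee1\big)$, the final outcome $\widehat U=\widehat U^{(T)}$ satisfies $$\big\|\sin\Theta(\widehat U,U)\big\|\lesssim\frac{\|\Delta(Z)\|}{\lambda_r(M)}\wedge1.$$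
   Context: $a\vee b=\max(a,b)$, $a\wedge b=\min(a,b)$; $\lesssim$ is inequality up to a universal constant factor; $T=\Omega(x)$ means $T\ge C_1x$ for a sufficiently large universal constant $C_1$. $\lambda_k(M)$ is the $k$-th largest singular value; $\|M\|=\lambda_1(M)$ the spectral norm. $\mathbb{O}_{p,r}=\{U\in\mathbb{R}^{p\times r}:U^\top U=I_r\}$; $\|\sin\Theta(U_1,U_2)\|=\|U_{1\perp}^\top U_2\|$, with $U_{1\perp}\in\mathbb{O}_{p,p-r}$ an orthogonal complement of $U_1$. $I(U)=\frac pr\max_{1\le i\le p}\|e_i^\top U\|_2^2$. For a square matrix $A$, $D(A)$ is $A$ with off-diagonal entries set to zero, and $\Delta(A)=A-D(A)$. HeteroPCA (input: symmetric matrix $N$, rank $r$, number of iterations $T$). Set $N^{(0)}=\Delta(N)$. For $t=0,1,2,\ldots$: take an SVD $N^{(t)}=\sum_i\lambda_i^{(t)}u_i^{(t)}(v_i^{(t)})^\top$ with $\lambda_1^{(t)}\ge\lambda_2^{(t)}\ge\cdots\ge0$; let $\widetilde N^{(t)}=\sum_{i=1}^r\lambda_i^{(t)}u_i^{(t)}(v_i^{(t)})^\top$; set $N^{(t+1)}=D(\widetilde N^{(t)})+\Delta(N^{(t)})$. The output is $\widehat U=[u_1^{(T)}\ \cdots\ u_r^{(T)}]$. *)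

theory Defs
  imports Complex_Main "Jordan_Normal_Form.DL_Rank" "Jordan_Normal_Form.Char_Poly"
begin

(* Matrices are taken from Jordan_Normal_Form (dimensions are natural numbers, not types), so
   that constants can be quantified before the dimensions p and r. Indices start at 0. *)

(* Square roots of the eigenvalues of A^T A, with multiplicity, in decreasing order. The list has
   length dim_col A: if A has more columns than rows, it ends with additional zeros. *)
definition sing_vals :: "real mat \<Rightarrow> real list" where
  "sing_vals A =
     rev (sorted_list_of_multiset
       (image_mset sqrt (proots (char_poly (transpose_mat A * A)))))"

(* k is 1-based and meant for 1 <= k <= dim_col A. *)
definition sing_val :: "nat \<Rightarrow> real mat \<Rightarrow> real" where
  "sing_val k A = sing_vals A ! (k - 1)"

definition spec_norm :: "real mat \<Rightarrow> real" where
  "spec_norm A = sing_val 1 A"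

definition orth_frames :: "nat \<Rightarrow> nat \<Rightarrow> real mat set" where
  "orth_frames p r = {U \<in> carrier_mat p r. transpose_mat U * U = 1\<^sub>m r}"

definition orth_complement :: "real mat \<Rightarrow> real mat \<Rightarrow> bool" where
  "orth_complement U W \<longleftrightarrow>
     W \<in> orth_frames (dim_row U) (dim_row U - dim_col U) \<and>
     transpose_mat U * W = 0\<^sub>m (dim_col U) (dim_row U - dim_col U)"

(* For U1 with orthonormal columns, orthogonal complements exist and differ only by an orthogonal
   factor on the right, so the norm does not depend on the one chosen. *)
definition sin_theta_norm :: "real mat \<Rightarrow> real mat \<Rightarrow> real" where
  "sin_theta_norm U1 U2 = spec_norm (transpose_mat (SOME W. orth_complement U1 W) * U2)"

definition incoherence :: "real mat \<Rightarrow> real" where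
  "incoherence U =
     real (dim_row U) / real (dim_col U) *
     Max ((\<lambda>i. row U i \<bullet> row U i) ` {..<dim_row U})"

definition diag_part :: "real mat \<Rightarrow> real mat" where
  "diag_part A =
     mat (dim_row A) (dim_col A) (\<lambda>(i, j). if i = j then A $$ (i, j) else 0)"

definition off_diag :: "real mat \<Rightarrow> real mat" where
  "off_diag A = A - diag_part A"

(* The sum of s_i u_i v_i^T over i < k, for the columns u_i of L and v_i of R. *)
definition svd_sum :: "nat \<Rightarrow> real mat \<Rightarrow> (nat \<Rightarrow> real) \<Rightarrow> real mat \<Rightarrow> real mat" where
  "svd_sum k L s R =
     mat (dim_row L) (dim_row R) (\<lambda>(a, b). \<Sum>i<k. s i * L $$ (a, i) * R $$ (b, i))"

definition is_svd :: "nat \<Rightarrow> real mat \<Rightarrow> real mat \<Rightarrow> (nat \<Rightarrow> real) \<Rightarrow> real mat \<Rightarrow> bool" where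
  "is_svd p A L s R \<longleftrightarrow>
     L \<in> orth_frames p p \<and> R \<in> orth_frames p p \<and>
     (\<forall>i<p. 0 \<le> s i) \<and> (\<forall>i j. i \<le> j \<longrightarrow> j < p \<longrightarrow> s j \<le> s i) \<and>
     A = svd_sum p L s R"

(* An SVD need not be unique, so the algorithm is given as a relation: A t is the iterate at time t
   and (L t, s t, R t) is the SVD of A t that was used, which may be any SVD. *)
definition heteroPCA_run ::
  "real mat \<Rightarrow> nat \<Rightarrow> (nat \<Rightarrow> real mat) \<Rightarrow> (nat \<Rightarrow> real mat) \<Rightarrow> (nat \<Rightarrow> nat \<Rightarrow> real) \<Rightarrow> (nat \<Rightarrow> real mat) \<Rightarrow> bool"
  where
  "heteroPCA_run N r A L s R \<longleftrightarrow>
     A 0 = off_diag N \<and>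
     (\<forall>t. is_svd (dim_row N) (A t) (L t) (s t) (R t)) \<and>
     (\<forall>t. A (Suc t) = diag_part (svd_sum r (L t) (s t) (R t)) + off_diag (A t))"

definition first_cols :: "nat \<Rightarrow> real mat \<Rightarrow> real mat" where
  "first_cols r L = mat (dim_row L) r (\<lambda>(i, j). L $$ (i, j))"

end

theory Submission
  imports Defs "HOL-Analysis.L2_Norm" "HOL-Analysis.Function_Topology"
begin

text \<open>
  Let \<open>\<lambda> = \<lambda>\<^sub>r(M)\<close>, \<open>\<delta> = \<parallel>\<Delta>(Z)\<parallel>\<close> and let \<open>P\<close> be the projection onto the range of \<open>M\<close>. The iterates agree
  with \<open>M + Z\<close> off the diagonal, so the error \<open>E\<^sub>t = A\<^sub>t - M\<close> is \<open>\<Delta>(Z)\<close> plus a diagonal matrix. Let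
  \<open>d\<^sub>t\<close> bound that diagonal, so that \<open>\<parallel>E\<^sub>t\<parallel> \<le> K\<^sub>t = \<delta> + d\<^sub>t\<close>. A bound on \<open>K\<^sub>t\<close> is all that is needed: if \<open>H\<close>
  projects onto the leading \<open>r\<close> left singular vectors of \<open>A\<^sub>t\<close>, then \<open>\<parallel>(1 - H) P\<parallel> \<le> 2 K\<^sub>t / \<lambda>\<close>
  (\<open>sin_theta_le\<close>), because \<open>M\<close> has rank \<open>r\<close> and therefore \<open>s\<^sub>r\<^sub>+\<^sub>1(A\<^sub>t) \<le> K\<^sub>t\<close>.

  The diagonal of the next error is that of \<open>H A\<^sub>t - M = H E\<^sub>t - (1 - H) M\<close>. Incoherence says that each
  coordinate vector \<open>e\<close> is almost orthogonal to the range of \<open>M\<close>: \<open>\<parallel>P e\<parallel> \<le> m\<close> with \<open>m\<close> tiny. Hence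
  \<open>e \<bullet> (1 - H) M e\<close> is at most \<open>2 K\<^sub>t m\<close>, and \<open>\<parallel>H e\<parallel>\<close> is at most \<open>y + m\<close>, where \<open>y = \<parallel>H (1 - P)\<parallel>\<close>. The
  term \<open>e \<bullet> H E\<^sub>t e\<close> is split: the off-diagonal part of \<open>E\<^sub>t\<close> contributes at most \<open>\<delta> \<parallel>H e\<parallel>\<close>, but for the
  diagonal part \<open>c e\<close> the factor \<open>\<parallel>H e\<parallel>\<close> occurs twice. Up to terms with \<open>m\<close> this gives
  \<open>d\<^sub>t\<^sub>+\<^sub>1 \<le> \<delta> y + d\<^sub>t y\<^sup>2\<close> (\<open>diag_error_le\<close>).

  If \<open>y\<close> is below \<open>1/2\<close>, then \<open>d\<^sub>t\<^sub>+\<^sub>1 \<le> \<delta>/2 + d\<^sub>t/4\<close>, hence \<open>d\<^sub>t \<le> (2/3) \<delta> + \<epsilon> \<lambda> 4\<^sup>-\<^sup>t\<close> with a small constant \<open>\<epsilon>\<close>. Only the case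
  \<open>4 \<delta> < \<lambda>\<close> matters, as a sine is at most \<open>1\<close>; so \<open>K\<^sub>t\<close> stays below about \<open>(5/12) \<lambda>\<close>. In this range the
  usual bound \<open>y \<le> K/(\<lambda> - K)\<close> gives only \<open>5/7\<close>, which would not close the recursion. The double-angle
  bound \<open>\<parallel>(1 - P) H P\<parallel> \<le> K/\<lambda>\<close> (\<open>sin_two_theta_le\<close>) does: it gives \<open>y\<^sup>2 (1 - y\<^sup>2) \<le> (K/\<lambda>)\<^sup>2\<close>, so that \<open>y\<close> is
  either below \<open>12/25\<close> or above \<open>7/8\<close>, and the usual bound rules out the latter (\<open>leakage_le\<close>).

  With \<open>d\<^sub>t\<close> as above, \<open>2 K\<^sub>t / \<lambda> \<le> (10/3) \<delta>/\<lambda> + 2 \<epsilon> 4\<^sup>-\<^sup>t\<close>, which is stronger than the first claim. The second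
  claim follows because \<open>2\<^sup>-\<^sup>T \<le> \<delta>/\<lambda>\<close> after logarithmically many steps.
\<close>

section \<open>Euclidean norm and sums of weighted rank-one matrices\<close>

text \<open>As an instance of \<open>L2_set\<close>, the norm inherits the Cauchy-Schwarz and the triangle inequality.\<close>

definition vnorm :: "real vec \<Rightarrow> real" where
  "vnorm v = L2_set (\<lambda>i. v $ i) {0..<dim_vec v}"

lemma vnorm_nonneg [simp]: "0 \<le> vnorm v"
  by (simp add: vnorm_def)

lemma vnorm_sq: "(vnorm v)\<^sup>2 = v \<bullet> v"
  by (simp add: vnorm_def L2_set_def scalar_prod_def sum_nonneg power2_eq_square)

lemma vnorm_sq_sum: "(vnorm v)\<^sup>2 = (\<Sum>i<dim_vec v. (v $ i)\<^sup>2)"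
  unfolding vnorm_sq by (simp add: scalar_prod_def atLeast0LessThan power2_eq_square)

lemma vnorm_eq_0_iff: "v \<in> carrier_vec n \<Longrightarrow> vnorm v = 0 \<longleftrightarrow> v = 0\<^sub>v n"
  by (auto simp: vnorm_def L2_set_eq_0_iff)

lemma vnorm_smult: "vnorm (c \<cdot>\<^sub>v v) = \<bar>c\<bar> * vnorm v"
proof -
  have "vnorm (c \<cdot>\<^sub>v v) = L2_set (\<lambda>i. \<bar>c\<bar> * \<bar>v $ i\<bar>) {0..<dim_vec v}"
    unfolding vnorm_def L2_set_def by (intro arg_cong[where f=sqrt] sum.cong) (auto simp: power_mult_distrib)
  also have "\<dots> = \<bar>c\<bar> * L2_set (\<lambda>i. \<bar>v $ i\<bar>) {0..<dim_vec v}"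
    by (simp add: L2_set_right_distrib)
  also have "\<dots> = \<bar>c\<bar> * vnorm v" by (simp add: vnorm_def L2_set_def)
  finally show ?thesis .
qed

lemma vnorm_uminus: "vnorm (- v) = vnorm v"
  by (simp add: vnorm_def L2_set_def)

lemma scalar_prod_le_vnorm:
  assumes "x \<in> carrier_vec n" "y \<in> carrier_vec n"
  shows "\<bar>x \<bullet> y\<bar> \<le> vnorm x * vnorm y"
proof -
  have "\<bar>x \<bullet> y\<bar> \<le> (\<Sum>i\<in>{0..<n}. \<bar>x $ i\<bar> * \<bar>y $ i\<bar>)"
    using assms unfolding scalar_prod_def
    by (auto intro!: order.trans[OF sum_abs] sum_mono simp: abs_mult)
  also have "\<dots> \<le> vnorm x * vnorm y"
    using L2_set_mult_ineq[of "\<lambda>i. x $ i" "\<lambda>i. y $ i" "{0..<n}"] assms by (auto simp: vnorm_def)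
  finally show ?thesis .
qed

lemma vnorm_add_le:
  assumes "x \<in> carrier_vec n" "y \<in> carrier_vec n"
  shows "vnorm (x + y) \<le> vnorm x + vnorm y"
proof -
  have "vnorm (x + y) = L2_set (\<lambda>i. x $ i + y $ i) {0..<n}"
    using assms unfolding vnorm_def by (intro L2_set_cong) auto
  also have "\<dots> \<le> vnorm x + vnorm y"
    using assms L2_set_triangle_ineq by (auto simp: vnorm_def)
  finally show ?thesis .
qed

lemma vnorm_diff_le:
  assumes "x \<in> carrier_vec n" "y \<in> carrier_vec n"
  shows "vnorm (x - y) \<le> vnorm x + vnorm y"
proof -
  have "x - y = x + (- y)" using assms by auto
  then show ?thesis using vnorm_add_le[of x n "-y"] assms by (simp add: vnorm_uminus)
qed

lemma mult_mat_vec_adjoint: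
  assumes "B \<in> carrier_mat m n" "x \<in> carrier_vec m" "y \<in> carrier_vec n"
  shows "x \<bullet> (B *\<^sub>v y) = (B\<^sup>T *\<^sub>v x) \<bullet> (y :: real vec)"
  using assms transpose_vec_mult_scalar[of B m n y x] 
  by (metis comm_scalar_prod mult_mat_vec_carrier transpose_carrier_mat)

lemma transpose_svd_sum: "(svd_sum k L s R)\<^sup>T = svd_sum k R s L"
  by (intro eq_matI) (auto simp: svd_sum_def algebra_simps)

lemma orth_frames_cols:
  assumes "V \<in> orth_frames p n" "i < n" "j < n"
  shows "(\<Sum>c<p. V $$ (c,i) * V $$ (c,j)) = (if i = j then 1 else 0)"
proof -
  have c: "V \<in> carrier_mat p n" and e: "V\<^sup>T * V = 1\<^sub>m n" using assms by (auto simp: orth_frames_def)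
  have "(V\<^sup>T * V) $$ (i,j) = (\<Sum>c<p. V $$ (c,i) * V $$ (c,j))"
    using c assms by (auto simp: scalar_prod_def atLeast0LessThan intro!: sum.cong)
  then show ?thesis using e assms by simp
qed

lemma orth_framesI:
  assumes "V \<in> carrier_mat p n"
    and "\<And>i j. i < n \<Longrightarrow> j < n \<Longrightarrow> (\<Sum>c<p. V $$ (c,i) * V $$ (c,j)) = (if i = j then 1 else 0)"
  shows "V \<in> orth_frames p n"
proof -
  have "(V\<^sup>T * V) $$ (i,j) = (\<Sum>c<p. V $$ (c,i) * V $$ (c,j))" if "i < n" "j < n" for i j
    using assms(1) that by (auto simp: scalar_prod_def atLeast0LessThan intro!: sum.cong)
  then show ?thesis using assms by (auto simp: orth_frames_def intro!: eq_matI)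
qed

lemma svd_sum_cong: "(\<And>i. i < k \<Longrightarrow> a i = b i) \<Longrightarrow> svd_sum k W a V = svd_sum k W b V"
  by (auto simp: svd_sum_def intro!: eq_matI sum.cong)

text \<open>Matrices of the form \<open>svd_sum\<close> over a common orthonormal frame multiply like their weights. The
matrix \<open>M\<close>, its pseudo-inverse, the iterates, their truncations and all projections have this form,
so this one rule replaces most of the matrix algebra.\<close>

lemma svd_sum_mult:
  assumes V: "V \<in> orth_frames p n" and k: "k \<le> n" and m: "m \<le> n"
  shows "svd_sum k L s V * svd_sum m V t Q = svd_sum (min k m) L (\<lambda>i. s i * t i) Q"
proof (rule eq_matI)
  have dV: "dim_row V = p" using V by (auto simp: orth_frames_def)
  fix a b
  assume "a < dim_row (svd_sum (min k m) L (\<lambda>i. s i * t i) Q)"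
    and "b < dim_col (svd_sum (min k m) L (\<lambda>i. s i * t i) Q)"
  then have a: "a < dim_row L" and b: "b < dim_row Q" by (auto simp: svd_sum_def)
  have "(svd_sum k L s V * svd_sum m V t Q) $$ (a,b) =
     (\<Sum>c<p. (\<Sum>i<k. s i * L $$ (a,i) * V $$ (c,i)) * (\<Sum>j<m. t j * V $$ (c,j) * Q $$ (b,j)))"
    using a b dV by (simp add: svd_sum_def scalar_prod_def atLeast0LessThan)
  also have "\<dots> = (\<Sum>c<p. \<Sum>i<k. \<Sum>j<m. (s i * L $$ (a,i) * t j * Q $$ (b,j)) * (V $$ (c,i) * V $$ (c,j)))"
    by (simp add: sum_product algebra_simps)
  also have "\<dots> = (\<Sum>i<k. \<Sum>j<m. (s i * L $$ (a,i) * t j * Q $$ (b,j)) * (\<Sum>c<p. V $$ (c,i) * V $$ (c,j)))"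
    by (subst sum.swap, rule sum.cong[OF refl], subst sum.swap) (simp add: sum_distrib_left)
  also have "\<dots> = (\<Sum>i<k. \<Sum>j<m. if i = j then s i * t i * L $$ (a,i) * Q $$ (b,i) else 0)"
    using k m by (intro sum.cong refl) (auto simp: orth_frames_cols[OF V])
  also have "\<dots> = (\<Sum>i\<in>{..<k}. if i < m then s i * t i * L $$ (a,i) * Q $$ (b,i) else 0)"
    by (intro sum.cong refl) (auto)
  also have "\<dots> = (\<Sum>i\<in>{..<min k m}. s i * t i * L $$ (a,i) * Q $$ (b,i))"
    by (subst sum.inter_filter[symmetric]) (auto intro!: sum.cong)
  finally show "(svd_sum k L s V * svd_sum m V t Q) $$ (a,b) = svd_sum (min k m) L (\<lambda>i. s i * t i) Q $$ (a,b)"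
    using a b by (simp add: svd_sum_def)
qed (auto simp: svd_sum_def)

lemma svd_sum_mult_vec:
  assumes V: "V \<in> orth_frames p n" and k: "k \<le> n" "m \<le> n" and v: "v \<in> carrier_vec (dim_row Q)"
  shows "svd_sum k L s V *\<^sub>v (svd_sum m V t Q *\<^sub>v v) = svd_sum (min k m) L (\<lambda>i. s i * t i) Q *\<^sub>v v"
proof -
  have "dim_row V = p" using V by (auto simp: orth_frames_def)
  then have "svd_sum k L s V *\<^sub>v (svd_sum m V t Q *\<^sub>v v) = (svd_sum k L s V * svd_sum m V t Q) *\<^sub>v v"
    using v by (intro assoc_mult_mat_vec[symmetric, of _ "dim_row L" p _ "dim_row Q"]) (auto simp: svd_sum_def)
  then show ?thesis unfolding svd_sum_mult[OF V k] .
qed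

lemma scalar_prod_svd_sum:
  assumes "x \<in> carrier_vec (dim_row L)" "y \<in> carrier_vec (dim_row R)" "k \<le> dim_col L" "k \<le> dim_col R"
  shows "x \<bullet> (svd_sum k L s R *\<^sub>v y) = (\<Sum>i<k. s i * (col L i \<bullet> x) * (col R i \<bullet> y))"
proof -
  have "x \<bullet> (svd_sum k L s R *\<^sub>v y) =
     (\<Sum>a<dim_row L. x $ a * (\<Sum>b<dim_row R. (\<Sum>i<k. s i * L $$ (a,i) * R $$ (b,i)) * y $ b))"
    using assms by (auto simp: svd_sum_def scalar_prod_def atLeast0LessThan intro!: sum.cong)
  also have "\<dots> = (\<Sum>a<dim_row L. \<Sum>b<dim_row R. \<Sum>i<k. s i * (L $$ (a,i) * x $ a) * (R $$ (b,i) * y $ b))"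
    by (simp add: sum_distrib_left sum_distrib_right algebra_simps)
  also have "\<dots> = (\<Sum>a<dim_row L. \<Sum>i<k. \<Sum>b<dim_row R. s i * (L $$ (a,i) * x $ a) * (R $$ (b,i) * y $ b))"
    by (rule sum.cong[OF refl], rule sum.swap)
  also have "\<dots> = (\<Sum>i<k. \<Sum>a<dim_row L. \<Sum>b<dim_row R. s i * (L $$ (a,i) * x $ a) * (R $$ (b,i) * y $ b))"
    by (rule sum.swap)
  also have "\<dots> = (\<Sum>i<k. s i * (col L i \<bullet> x) * (col R i \<bullet> y))"
  proof (rule sum.cong[OF refl])
    fix i assume "i \<in> {..<k}"
    then have i: "i < dim_col L" "i < dim_col R" using assms by auto
    have "col L i \<bullet> x = (\<Sum>a<dim_row L. L $$ (a,i) * x $ a)"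
      "col R i \<bullet> y = (\<Sum>b<dim_row R. R $$ (b,i) * y $ b)"
      using assms i by (auto simp: scalar_prod_def atLeast0LessThan)
    then show "(\<Sum>a<dim_row L. \<Sum>b<dim_row R. s i * (L $$ (a,i) * x $ a) * (R $$ (b,i) * y $ b)) =
      s i * (col L i \<bullet> x) * (col R i \<bullet> y)"
      by (simp add: sum_product sum_distrib_left algebra_simps)
  qed
  finally show ?thesis .
qed

lemma vnorm_svd_sum:
  assumes L: "L \<in> orth_frames p n" and k: "k \<le> n" "k \<le> dim_col R" and v: "v \<in> carrier_vec (dim_row R)"
  shows "(vnorm (svd_sum k L s R *\<^sub>v v))\<^sup>2 = (\<Sum>i<k. (s i)\<^sup>2 * (col R i \<bullet> v)\<^sup>2)"
proof -
  let ?B = "svd_sum k L s R"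
  have dL: "dim_row L = p" using L by (auto simp: orth_frames_def)
  have B: "?B \<in> carrier_mat p (dim_row R)" using dL by (simp add: svd_sum_def)
  have "(vnorm (?B *\<^sub>v v))\<^sup>2 = v \<bullet> (?B\<^sup>T *\<^sub>v (?B *\<^sub>v v))"
    using B v by (simp add: vnorm_sq mult_mat_vec_adjoint[OF B] comm_scalar_prod[of v "dim_row R"])
  also have "?B\<^sup>T *\<^sub>v (?B *\<^sub>v v) = (?B\<^sup>T * ?B) *\<^sub>v v"
    using B v by (simp add: assoc_mult_mat_vec[of _ "dim_row R" p _ "dim_row R"])
  also have "?B\<^sup>T * ?B = svd_sum k R (\<lambda>i. s i * s i) R"
    unfolding transpose_svd_sum using svd_sum_mult[OF L k(1) k(1)] by simp
  also have "v \<bullet> (\<dots> *\<^sub>v v) = (\<Sum>i<k. (s i)\<^sup>2 * (col R i \<bullet> v)\<^sup>2)"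
    using k v by (subst scalar_prod_svd_sum) (auto simp: power2_eq_square algebra_simps)
  finally show ?thesis .
qed

lemma svd_sum_complete:
  assumes "Q \<in> orth_frames p p"
  shows "svd_sum p Q (\<lambda>_. 1) Q = 1\<^sub>m p"
proof -
  have c: "Q \<in> carrier_mat p p" "Q\<^sup>T * Q = 1\<^sub>m p" using assms by (auto simp: orth_frames_def)
  then have "Q * Q\<^sup>T = 1\<^sub>m p" by (intro mat_mult_left_right_inverse[of "Q\<^sup>T" p Q]) auto
  moreover have "Q * Q\<^sup>T = svd_sum p Q (\<lambda>_. 1) Q"
    using c by (intro eq_matI) (auto simp: svd_sum_def scalar_prod_def atLeast0LessThan)
  ultimately show ?thesis by simp
qed

section \<open>The spectral norm is the operator norm\<close>

text \<open>The dimension is a number and not a type, so the unit sphere is realised inside the functions on the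
natural numbers, as a closed subset of a product of intervals, which is compact by Tychonov.\<close>

lemma sphere_maximizer:
  fixes A :: "real mat"
  assumes A: "A \<in> carrier_mat m n" and n: "0 < n"
  obtains v where "v \<in> carrier_vec n" "vnorm v = 1"
    "\<And>w. w \<in> carrier_vec n \<Longrightarrow> vnorm (A *\<^sub>v w) \<le> vnorm (A *\<^sub>v v) * vnorm w"
proof -
  define K where "K = (PiE UNIV (\<lambda>i. if i < n then {-1..1::real} else {0})) \<inter> {g. (\<Sum>i<n. (g i)\<^sup>2) = 1}"
  define f where "f g = (\<Sum>a<m. (\<Sum>b<n. A $$ (a,b) * g b)\<^sup>2)" for g :: "nat \<Rightarrow> real"
  have "compact (PiE UNIV (\<lambda>i::nat. if i < n then {-1..1::real} else {0}))"
    using compactin_PiE[of "\<lambda>_::nat. euclidean :: real topology" UNIV]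
    by (auto simp: euclidean_product_topology)
  moreover have "closed {g::nat \<Rightarrow> real. (\<Sum>i<n. (g i)\<^sup>2) = 1}"
    by (intro closed_Collect_eq continuous_intros) auto
  ultimately have K: "compact K" unfolding K_def by auto
  have "(\<lambda>i. if i = 0 then 1 else 0) \<in> K"
    using n by (auto simp: K_def if_distrib[of "\<lambda>x. x ^ 2"] cong: if_cong)
  then have ne: "K \<noteq> {}" by auto
  have "continuous_on UNIV f"
    unfolding f_def by (intro continuous_intros) auto
  then have "continuous_on K f" by (rule continuous_on_subset) auto
  from continuous_attains_sup[OF K ne this] obtain g where g: "g \<in> K" and max: "\<And>h. h \<in> K \<Longrightarrow> f h \<le> f g"
    by auto
  have sq: "(vnorm (A *\<^sub>v w))\<^sup>2 = f (\<lambda>i. if i < n then w $ i else 0)" if "w \<in> carrier_vec n" for w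
    using A that by (auto simp: vnorm_def L2_set_def sum_nonneg f_def scalar_prod_def atLeast0LessThan intro!: sum.cong)
  have sq1: "(vnorm w)\<^sup>2 = (\<Sum>i<n. (w $ i)\<^sup>2)" if "w \<in> carrier_vec n" for w
    using that by (auto simp: vnorm_def L2_set_def sum_nonneg atLeast0LessThan intro!: sum.cong)
  define v where "v = vec n g"
  have v: "v \<in> carrier_vec n" by (simp add: v_def)
  have gv: "(\<lambda>i. if i < n then v $ i else 0) = g" using g by (auto simp: v_def K_def fun_eq_iff PiE_iff split: if_splits)
  have "(vnorm v)\<^sup>2 = 1" using g v by (simp add: sq1) (simp add: v_def K_def)
  then have v1: "vnorm v = 1" using vnorm_nonneg[of v] by (simp add: power2_eq_1_iff)
  have unit: "vnorm (A *\<^sub>v w) \<le> vnorm (A *\<^sub>v v)" if w: "w \<in> carrier_vec n" "vnorm w = 1" for w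
  proof -
    have s: "(\<Sum>i<n. (w $ i)\<^sup>2) = 1" using sq1[OF w(1)] w(2) by simp
    have "\<bar>w $ i\<bar> \<le> 1" if "i < n" for i
    proof -
      have "(w $ i)\<^sup>2 \<le> (\<Sum>i<n. (w $ i)\<^sup>2)" by (rule member_le_sum) (use that in auto)
      then show ?thesis using s by (simp add: abs_square_le_1)
    qed
    then have "(\<lambda>i. if i < n then w $ i else 0) \<in> K" using s by (auto simp: K_def abs_le_iff)
    then have "(vnorm (A *\<^sub>v w))\<^sup>2 \<le> (vnorm (A *\<^sub>v v))\<^sup>2"
      using max by (simp add: sq[OF w(1)] sq[OF v] gv)
    then show ?thesis using power2_le_imp_le vnorm_nonneg by blast
  qed
  have "vnorm (A *\<^sub>v w) \<le> vnorm (A *\<^sub>v v) * vnorm w" if w: "w \<in> carrier_vec n" for w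
  proof (cases "vnorm w = 0")
    case True
    then have "w = 0\<^sub>v n" using w vnorm_eq_0_iff by blast
    then have "A *\<^sub>v w = 0\<^sub>v m" using A by auto
    then show ?thesis using True vnorm_eq_0_iff[of "0\<^sub>v m" m] by simp
  next
    case False
    let ?c = "1 / vnorm w"
    have "vnorm (?c \<cdot>\<^sub>v w) = 1" using False by (simp add: vnorm_smult)
    then have "vnorm (A *\<^sub>v (?c \<cdot>\<^sub>v w)) \<le> vnorm (A *\<^sub>v v)" using unit w by simp
    moreover have "vnorm (A *\<^sub>v (?c \<cdot>\<^sub>v w)) = vnorm (A *\<^sub>v w) / vnorm w"
      using A w by (simp add: mult_mat_vec[of A m n] vnorm_smult)
    moreover have "0 < vnorm w" using False vnorm_nonneg[of w] by linarith
    ultimately show ?thesis by (simp add: divide_le_eq)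
  qed
  with v v1 show ?thesis using that by blast
qed

text \<open>First-order optimality: the form \<open>q(x) = \<parallel>A v\<parallel>\<^sup>2 \<parallel>x\<parallel>\<^sup>2 - \<parallel>A x\<parallel>\<^sup>2\<close> is nonnegative and vanishes at \<open>v\<close>, so its
gradient \<open>2 w\<close> at \<open>v\<close> vanishes; otherwise a small step from \<open>v\<close> against \<open>w\<close> would make \<open>q\<close> negative.\<close>

lemma rayleigh_maximizer_eigenvector:
  fixes A :: "real mat"
  assumes A: "A \<in> carrier_mat m n" and v: "v \<in> carrier_vec n" "vnorm v = 1"
    and max: "\<And>w. w \<in> carrier_vec n \<Longrightarrow> vnorm (A *\<^sub>v w) \<le> vnorm (A *\<^sub>v v) * vnorm w"
  shows "eigenvector (A\<^sup>T * A) v ((vnorm (A *\<^sub>v v))\<^sup>2)"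
proof -
  let ?l = "(vnorm (A *\<^sub>v v))\<^sup>2"
  let ?B = "A\<^sup>T * A"
  define w where "w = ?l \<cdot>\<^sub>v v - ?B *\<^sub>v v"
  have B: "?B \<in> carrier_mat n n" using A by auto
  have w: "w \<in> carrier_vec n" using B v by (simp add: w_def)
  define q where "q = ?l * (vnorm w)\<^sup>2 - (vnorm (A *\<^sub>v w))\<^sup>2"
  have nsq: "(vnorm (x + t \<cdot>\<^sub>v y))\<^sup>2 = (vnorm x)\<^sup>2 + 2 * t * (x \<bullet> y) + t\<^sup>2 * (vnorm y)\<^sup>2"
    if "x \<in> carrier_vec k" "y \<in> carrier_vec k" for x y t k
    using that unfolding vnorm_sq
    by (simp add: add_scalar_prod_distrib[of _ k] scalar_prod_add_distrib[of _ k] comm_scalar_prod[of y k x]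
        power2_eq_square algebra_simps)
  have key: "0 \<le> 2 * t * (vnorm w)\<^sup>2 + t\<^sup>2 * q" for t
  proof -
    have "(vnorm (A *\<^sub>v (v + t \<cdot>\<^sub>v w)))\<^sup>2 \<le> (vnorm (A *\<^sub>v v) * vnorm (v + t \<cdot>\<^sub>v w))\<^sup>2"
      using max[of "v + t \<cdot>\<^sub>v w"] v w by (intro power_mono) auto
    also have "\<dots> = ?l * (vnorm (v + t \<cdot>\<^sub>v w))\<^sup>2" by (simp add: power_mult_distrib)
    finally have "(vnorm (A *\<^sub>v v + t \<cdot>\<^sub>v (A *\<^sub>v w)))\<^sup>2 \<le> ?l * (vnorm (v + t \<cdot>\<^sub>v w))\<^sup>2"
      using A v w by (simp add: mult_add_distrib_mat_vec[of A m n] mult_mat_vec[of A m n])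
    then have 1: "?l + 2 * t * ((A *\<^sub>v v) \<bullet> (A *\<^sub>v w)) + t\<^sup>2 * (vnorm (A *\<^sub>v w))\<^sup>2 \<le> 
        ?l * (1 + 2 * t * (v \<bullet> w) + t\<^sup>2 * (vnorm w)\<^sup>2)"
      using A v w by (simp add: nsq[of _ m] nsq[of _ n])
    have 2: "(A *\<^sub>v v) \<bullet> (A *\<^sub>v w) = (?B *\<^sub>v v) \<bullet> w"
      using A v w by (subst mult_mat_vec_adjoint[of A m n]) (auto simp: assoc_mult_mat_vec[of _ n m _ n])
    have 3: "(vnorm w)\<^sup>2 = ?l * (v \<bullet> w) - (?B *\<^sub>v v) \<bullet> w"
    proof -
      have "w \<bullet> w = (?l \<cdot>\<^sub>v v - ?B *\<^sub>v v) \<bullet> w" by (subst (1) w_def) (rule refl)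
      then have "(vnorm w)\<^sup>2 = (?l \<cdot>\<^sub>v v - ?B *\<^sub>v v) \<bullet> w" by (simp add: vnorm_sq[of w])
      then show ?thesis using B v w by (subst (asm) minus_scalar_prod_distrib[of _ n]) auto
    qed
    have "2 * t * (vnorm w)\<^sup>2 = 2 * t * (?l * (v \<bullet> w)) - 2 * t * ((?B *\<^sub>v v) \<bullet> w)"
      by (subst 3) (simp only: right_diff_distrib)
    moreover have "t\<^sup>2 * q = t\<^sup>2 * (?l * (vnorm w)\<^sup>2) - t\<^sup>2 * (vnorm (A *\<^sub>v w))\<^sup>2"
      by (simp only: q_def right_diff_distrib)
    moreover have "?l * (1 + 2 * t * (v \<bullet> w) + t\<^sup>2 * (vnorm w)\<^sup>2) =
        ?l + 2 * t * (?l * (v \<bullet> w)) + t\<^sup>2 * (?l * (vnorm w)\<^sup>2)"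
      by (simp only: ring_distribs mult_1_right mult.left_commute)
    ultimately show ?thesis using 1 unfolding 2 by linarith
  qed
  have "vnorm w = 0"
  proof (rule ccontr)
    assume "vnorm w \<noteq> 0"
    then have a: "0 < (vnorm w)\<^sup>2" by simp
    have q: "q \<ge> 0"
      using max[OF w] unfolding q_def by (simp flip: power_mult_distrib)
    let ?e = "(vnorm w)\<^sup>2 / (q + 1)"
    have "?e * q \<le> (vnorm w)\<^sup>2" using a q by (simp add: field_simps)
    have e: "?e > 0" using a q by simp
    have "0 \<le> 2 * (- ?e) * (vnorm w)\<^sup>2 + (- ?e)\<^sup>2 * q" by (rule key)
    then have "0 \<le> ?e * (?e * q - 2 * (vnorm w)\<^sup>2)" by (simp add: power2_eq_square algebra_simps)
    then have "0 \<le> ?e * q - 2 * (vnorm w)\<^sup>2" using e by (metis zero_le_mult_iff not_le)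
    with \<open>?e * q \<le> (vnorm w)\<^sup>2\<close> a show False by linarith
  qed
  then have w0: "w = 0\<^sub>v n" using w vnorm_eq_0_iff by blast
  have "?B *\<^sub>v v = ?l \<cdot>\<^sub>v v"
  proof (rule eq_vecI)
    fix i assume "i < dim_vec (?l \<cdot>\<^sub>v v)"
    then have i: "i < n" using v by simp
    have "w $ i = 0" using w0 i by simp
    then show "(?B *\<^sub>v v) $ i = (?l \<cdot>\<^sub>v v) $ i" using i v A unfolding w_def by simp
  qed (use A v in auto)
  moreover have "v \<noteq> 0\<^sub>v n" using v vnorm_eq_0_iff[of "0\<^sub>v n" n] by auto
  ultimately show ?thesis using v A by (simp add: eigenvector_def)
qed

lemma nth_rev_sorted_list_of_multiset_0:
  fixes X :: "real multiset"
  assumes "x \<in># X" "\<And>y. y \<in># X \<Longrightarrow> y \<le> x"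
  shows "rev (sorted_list_of_multiset X) ! 0 = x"
proof -
  let ?xs = "sorted_list_of_multiset X"
  have ne: "?xs \<noteq> []" using assms(1) by (metis empty_iff list.set(1) set_sorted_list_of_multiset)
  have "rev ?xs ! 0 = last ?xs" using ne by (simp add: hd_conv_nth[symmetric] hd_rev)
  moreover have "last ?xs \<in># X" using last_in_set[OF ne] by simp
  moreover obtain i where "i < length ?xs" "x = ?xs ! i" using assms(1)
    by (metis in_set_conv_nth set_sorted_list_of_multiset)
  then have "x \<le> last ?xs" using ne sorted_sorted_list_of_multiset[of X]
    by (simp add: last_conv_nth sorted_nth_mono)
  ultimately show ?thesis using assms(2) by fastforce
qed

text \<open>The definition of the spectral norm through real roots of a characteristic polynomial becomes usable
here: the maximum of \<open>\<parallel>A v\<parallel>\<close> on the sphere is the square root of an eigenvalue of \<open>A\<^sup>T A\<close>, and no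
eigenvalue can exceed its square.\<close>

lemma spec_norm_attained:
  fixes A :: "real mat"
  assumes A: "A \<in> carrier_mat m n" and n: "0 < n"
  obtains v where "v \<in> carrier_vec n" "vnorm v = 1" "vnorm (A *\<^sub>v v) = spec_norm A"
    "\<And>w. w \<in> carrier_vec n \<Longrightarrow> vnorm (A *\<^sub>v w) \<le> spec_norm A * vnorm w"
proof -
  obtain v where v: "v \<in> carrier_vec n" "vnorm v = 1"
    and max: "\<And>w. w \<in> carrier_vec n \<Longrightarrow> vnorm (A *\<^sub>v w) \<le> vnorm (A *\<^sub>v v) * vnorm w"
    using sphere_maximizer[OF A n] by metis
  let ?l = "vnorm (A *\<^sub>v v)"
  let ?B = "A\<^sup>T * A"
  have B: "?B \<in> carrier_mat n n" using A by auto
  have nz: "char_poly ?B \<noteq> 0" using degree_monic_char_poly[OF B] n by auto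
  have root: "poly (char_poly ?B) k = 0 \<longleftrightarrow> eigenvalue ?B k" for k
    using eigenvalue_root_char_poly[OF B] by simp
  have "rev (sorted_list_of_multiset (image_mset sqrt (proots (char_poly ?B)))) ! 0 = ?l"
  proof (rule nth_rev_sorted_list_of_multiset_0)
    have "eigenvalue ?B (?l\<^sup>2)" using rayleigh_maximizer_eigenvector[OF A v max] by (auto simp: eigenvalue_def)
    then have "?l\<^sup>2 \<in># proots (char_poly ?B)" using nz root by simp
    then have "sqrt (?l\<^sup>2) \<in># image_mset sqrt (proots (char_poly ?B))" by (metis image_eqI set_image_mset)
    then show "?l \<in># image_mset sqrt (proots (char_poly ?B))" by simp
  next
    fix y assume "y \<in># image_mset sqrt (proots (char_poly ?B))"
    then obtain k where k: "y = sqrt k" "eigenvalue ?B k" using nz root by auto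
    then obtain w where w: "w \<in> carrier_vec n" "w \<noteq> 0\<^sub>v n" "?B *\<^sub>v w = k \<cdot>\<^sub>v w"
      using A by (auto simp: eigenvalue_def eigenvector_def)
    have "(vnorm (A *\<^sub>v w))\<^sup>2 = (?B *\<^sub>v w) \<bullet> w"
      unfolding vnorm_sq using A w(1)
      by (subst mult_mat_vec_adjoint[of A m n]) (auto simp: assoc_mult_mat_vec[of _ n m _ n])
    also have "\<dots> = k * (vnorm w)\<^sup>2" using w by (simp add: vnorm_sq)
    finally have e: "(vnorm (A *\<^sub>v w))\<^sup>2 = k * (vnorm w)\<^sup>2" .
    have "(vnorm (A *\<^sub>v w))\<^sup>2 \<le> (?l * vnorm w)\<^sup>2" using max[OF w(1)] by (intro power_mono) auto
    then have "k * (vnorm w)\<^sup>2 \<le> ?l\<^sup>2 * (vnorm w)\<^sup>2" using e by (simp add: power_mult_distrib)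
    moreover have "0 < (vnorm w)\<^sup>2" using w vnorm_eq_0_iff by (simp add: zero_less_power2)
    ultimately have "k \<le> ?l\<^sup>2" by simp
    then show "y \<le> ?l" using k by (simp add: real_le_lsqrt real_sqrt_le_iff sqrt_le_D)
  qed
  then have "spec_norm A = ?l" by (simp add: spec_norm_def sing_val_def sing_vals_def)
  then show ?thesis using that v max by metis
qed

lemma vnorm_mult_le_spec_norm:
  assumes "A \<in> carrier_mat m n" "0 < n" "w \<in> carrier_vec n"
  shows "vnorm (A *\<^sub>v w) \<le> spec_norm A * vnorm w"
  using spec_norm_attained[OF assms(1,2)] assms(3) by metis

lemma spec_norm_leI:
  assumes "A \<in> carrier_mat m n" "0 < n" "\<And>w. w \<in> carrier_vec n \<Longrightarrow> vnorm (A *\<^sub>v w) \<le> c * vnorm w"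
  shows "spec_norm A \<le> c"
  using spec_norm_attained[OF assms(1,2)] assms(3) by (metis mult.right_neutral)

lemma spec_norm_nonneg: "A \<in> carrier_mat m n \<Longrightarrow> 0 < n \<Longrightarrow> 0 \<le> spec_norm A"
  using spec_norm_attained vnorm_nonneg by metis

section \<open>Projections onto the span of leading frame columns\<close>

text \<open>For orthonormal columns this is the orthogonal projection onto the span of the first \<open>k\<close> of them. The form
as an \<open>svd_sum\<close> makes \<open>svd_sum_mult\<close> applicable.\<close>

definition frame_proj :: "nat \<Rightarrow> real mat \<Rightarrow> real mat" where
  "frame_proj k V = svd_sum k V (\<lambda>_. 1) V"

lemma frame_proj_carrier: "V \<in> orth_frames p n \<Longrightarrow> frame_proj k V \<in> carrier_mat p p"
  by (auto simp: frame_proj_def svd_sum_def orth_frames_def)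

lemma frame_proj_eq:
  assumes "V \<in> carrier_mat p k"
  shows "frame_proj k V = V * V\<^sup>T"
  using assms by (intro eq_matI) (auto simp: frame_proj_def svd_sum_def scalar_prod_def atLeast0LessThan)

text \<open>An orthogonal projection is used through its action on vectors: compositions such as \<open>(1 - P) H P\<close> then
reduce to rewriting with idempotence and symmetry.\<close>

locale frame_projection =
  fixes p n k :: nat and V :: "real mat"
  assumes V: "V \<in> orth_frames p n" and k: "k \<le> n"
begin

abbreviation "\<P> \<equiv> frame_proj k V"

lemma carr [simp]: "\<P> \<in> carrier_mat p p" using V by (rule frame_proj_carrier)

lemma dim [simp]: "dim_row \<P> = p" "dim_col \<P> = p" using carr carrier_matD by blast+

lemma vec_carr [simp]: "v \<in> carrier_vec p \<Longrightarrow> \<P> *\<^sub>v v \<in> carrier_vec p"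
  using mult_mat_vec_carrier[OF carr] .

lemma idem: "v \<in> carrier_vec p \<Longrightarrow> \<P> *\<^sub>v (\<P> *\<^sub>v v) = \<P> *\<^sub>v v"
  using V svd_sum_mult_vec[OF V k k, of v V V "\<lambda>_. 1" "\<lambda>_. 1"] by (auto simp: frame_proj_def orth_frames_def)

lemma sym: "x \<in> carrier_vec p \<Longrightarrow> y \<in> carrier_vec p \<Longrightarrow> x \<bullet> (\<P> *\<^sub>v y) = (\<P> *\<^sub>v x) \<bullet> y"
  by (subst mult_mat_vec_adjoint[OF carr]) (auto simp: frame_proj_def transpose_svd_sum)

lemma minus: "x \<in> carrier_vec p \<Longrightarrow> y \<in> carrier_vec p \<Longrightarrow> \<P> *\<^sub>v (x - y) = \<P> *\<^sub>v x - \<P> *\<^sub>v y"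
  by (rule mult_minus_distrib_mat_vec[OF carr])

lemma add: "x \<in> carrier_vec p \<Longrightarrow> y \<in> carrier_vec p \<Longrightarrow> \<P> *\<^sub>v (x + y) = \<P> *\<^sub>v x + \<P> *\<^sub>v y"
  by (rule mult_add_distrib_mat_vec[OF carr])

lemma pythagoras:
  assumes v: "v \<in> carrier_vec p"
  shows "(vnorm v)\<^sup>2 = (vnorm (\<P> *\<^sub>v v))\<^sup>2 + (vnorm (v - \<P> *\<^sub>v v))\<^sup>2"
proof -
  let ?w = "\<P> *\<^sub>v v"
  have w: "?w \<in> carrier_vec p" using v by simp
  have 1: "?w \<bullet> ?w = v \<bullet> ?w" using sym[OF v w] idem[OF v] by simp
  have "(v - ?w) \<bullet> (v - ?w) = v \<bullet> v - v \<bullet> ?w - (?w \<bullet> v - ?w \<bullet> ?w)"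
    using v w by (simp add: minus_scalar_prod_distrib[of _ p] scalar_prod_minus_distrib[of _ p])
  then show ?thesis unfolding vnorm_sq using 1 comm_scalar_prod[OF v w] by linarith
qed

lemma contraction: "v \<in> carrier_vec p \<Longrightarrow> vnorm (\<P> *\<^sub>v v) \<le> vnorm v"
  using pythagoras[of v] zero_le_power2[of "vnorm (v - \<P> *\<^sub>v v)"]
  by (intro power2_le_imp_le[OF _ vnorm_nonneg]) linarith

lemma co_contraction: "v \<in> carrier_vec p \<Longrightarrow> vnorm (v - \<P> *\<^sub>v v) \<le> vnorm v"
  using pythagoras[of v] zero_le_power2[of "vnorm (\<P> *\<^sub>v v)"]
  by (intro power2_le_imp_le[OF _ vnorm_nonneg]) linarith

lemma co_sym:
  "x \<in> carrier_vec p \<Longrightarrow> y \<in> carrier_vec p \<Longrightarrow> x \<bullet> (y - \<P> *\<^sub>v y) = (x - \<P> *\<^sub>v x) \<bullet> y"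
  by (simp add: minus_scalar_prod_distrib[of _ p] scalar_prod_minus_distrib[of _ p] sym)

end

section \<open>Orthonormal frames and matrices of low rank\<close>

text \<open>Padding with zero rows gives a square matrix of determinant zero.\<close>

lemma wide_kernel:
  assumes B: "B \<in> carrier_mat m n" and mn: "m < n"
  shows "\<exists>v \<in> carrier_vec n. v \<noteq> 0\<^sub>v n \<and> B *\<^sub>v v = (0\<^sub>v m :: real vec)"
proof -
  define C where "C = mat n n (\<lambda>(i,j). if i < m then B $$ (i,j) else 0)"
  have C: "C \<in> carrier_mat n n" by (simp add: C_def)
  have "C\<^sup>T *\<^sub>v unit_vec n m = 0\<^sub>v n"
    using mn by (intro eq_vecI) (auto simp: C_def scalar_prod_def unit_vec_def intro!: sum.neutral)
  moreover have "unit_vec n m \<noteq> (0\<^sub>v n :: real vec)"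
    using mn by (metis index_unit_vec(2) index_zero_vec(1) zero_neq_one)
  ultimately have "det (C\<^sup>T) = 0"
    using C by (subst det_0_iff_vec_prod_zero_field[of _ n]) (auto intro!: exI[of _ "unit_vec n m"])
  then have "det C = 0" using det_transpose[OF C] by simp
  then obtain v where v: "v \<in> carrier_vec n" "v \<noteq> 0\<^sub>v n" "C *\<^sub>v v = 0\<^sub>v n"
    using det_0_iff_vec_prod_zero_field[OF C] by auto
  have "B *\<^sub>v v = 0\<^sub>v m"
  proof (rule eq_vecI)
    fix i assume "i < dim_vec (0\<^sub>v m :: real vec)"
    then have i: "i < m" by simp
    have "row C i = row B i" using i mn B by (intro eq_vecI) (auto simp: C_def)
    then have "(B *\<^sub>v v) $ i = (C *\<^sub>v v) $ i" using i mn B C by simp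
    then show "(B *\<^sub>v v) $ i = 0\<^sub>v m $ i" using v i mn by simp
  qed (use B in auto)
  then show ?thesis using v by auto
qed

text \<open>The dimension count behind both singular value estimates for the perturbed matrix: a subspace of
dimension \<open>m\<close> meets the kernel of fewer than \<open>m\<close> linear forms.\<close>

lemma frame_meets_kernel:
  fixes B :: "real mat"
  assumes X: "X \<in> orth_frames p m" and B: "B \<in> carrier_mat n p" and nm: "n < m"
  obtains v where "v \<in> carrier_vec p" "v \<noteq> 0\<^sub>v p" "frame_proj m X *\<^sub>v v = v" "B *\<^sub>v v = 0\<^sub>v n"
proof -
  have Xc: "X \<in> carrier_mat p m" and XX: "X\<^sup>T * X = 1\<^sub>m m" using X by (auto simp: orth_frames_def)
  obtain a where a: "a \<in> carrier_vec m" "a \<noteq> 0\<^sub>v m" "(B * X) *\<^sub>v a = 0\<^sub>v n"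
    using wide_kernel[OF mult_carrier_mat[OF B Xc] nm] by blast
  define v where "v = X *\<^sub>v a"
  have v: "v \<in> carrier_vec p" using Xc a by (simp add: v_def)
  have Xv: "X\<^sup>T *\<^sub>v v = a"
    unfolding v_def using Xc a(1) XX by (subst assoc_mult_mat_vec[of _ m p _ m, symmetric]) auto
  have "frame_proj m X *\<^sub>v v = v"
    using Xc v by (simp add: frame_proj_eq[OF Xc] assoc_mult_mat_vec[of X p m "X\<^sup>T" p v] Xv) (simp add: v_def)
  moreover have "B *\<^sub>v v = 0\<^sub>v n" using B Xc a by (simp add: v_def assoc_mult_mat_vec[of B n p X m a])
  moreover have "v \<noteq> 0\<^sub>v p"
  proof
    assume "v = 0\<^sub>v p"
    then have "X\<^sup>T *\<^sub>v v = 0\<^sub>v m" using Xc by (auto intro!: eq_vecI simp: scalar_prod_def)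
    then show False using Xv a by simp
  qed
  ultimately show ?thesis using that v by blast
qed

lemma orth_frame_dim_le:
  assumes "U \<in> orth_frames p r"
  shows "r \<le> p"
proof (rule ccontr)
  assume "\<not> r \<le> p"
  then have "p < r" by simp
  then obtain v :: "real vec" where "v \<in> carrier_vec p" "v \<noteq> 0\<^sub>v p" "1\<^sub>m p *\<^sub>v v = 0\<^sub>v p"
    by (rule frame_meets_kernel[OF assms one_carrier_mat])
  then show False by (metis one_mult_mat_vec)
qed

lemma orth_frame_append:
  assumes U: "U \<in> orth_frames p k" and v: "v \<in> carrier_vec p" "v \<bullet> v = 1" "U\<^sup>T *\<^sub>v v = 0\<^sub>v k"
  shows "mat p (Suc k) (\<lambda>(i,j). if j < k then U $$ (i,j) else v $ i) \<in> orth_frames p (Suc k)"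
proof (rule orth_framesI)
  fix i j assume ij: "i < Suc k" "j < Suc k"
  have Uc: "U \<in> carrier_mat p k" using U by (auto simp: orth_frames_def)
  have z: "(\<Sum>c<p. U $$ (c,i) * v $ c) = 0" if "i < k" for i
  proof -
    have "(U\<^sup>T *\<^sub>v v) $ i = (\<Sum>c<p. U $$ (c,i) * v $ c)"
      using that Uc v(1) by (auto simp: scalar_prod_def atLeast0LessThan)
    then show ?thesis using v(3) that by simp
  qed
  have vv: "(\<Sum>c<p. v $ c * v $ c) = 1" using v by (simp add: scalar_prod_def atLeast0LessThan)
  have zz: "(\<Sum>c<p. v $ c * U $$ (c,i)) = 0" if "i < k" for i
    using z[OF that] by (simp add: mult.commute)
  show "(\<Sum>c<p. mat p (Suc k) (\<lambda>(i, j). if j < k then U $$ (i, j) else v $ i) $$ (c, i) *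
               mat p (Suc k) (\<lambda>(i, j). if j < k then U $$ (i, j) else v $ i) $$ (c, j)) =
           (if i = j then 1 else 0)"
    using ij orth_frames_cols[OF U, of i j] z[of i] zz[of j] vv
    by (cases "i < k"; cases "j < k") auto
qed auto

text \<open>As long as there are fewer than \<open>p\<close> columns, the forms \<open>col Q j \<bullet> _\<close> have a common nonzero zero,
which can be normalised and appended.\<close>

lemma orth_frame_extend:
  assumes U: "U \<in> orth_frames p r"
  obtains Q where "Q \<in> orth_frames p p" "\<And>i j. i < p \<Longrightarrow> j < r \<Longrightarrow> Q $$ (i,j) = U $$ (i,j)"
proof -
  have "\<exists>Q \<in> orth_frames p (r + k). \<forall>i<p. \<forall>j<r. Q $$ (i,j) = U $$ (i,j)" if "r + k \<le> p" for k
    using that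
  proof (induction k)
    case 0
    then show ?case using U by auto
  next
    case (Suc k)
    then obtain Q where Q: "Q \<in> orth_frames p (r + k)" "\<forall>i<p. \<forall>j<r. Q $$ (i,j) = U $$ (i,j)" by auto
    have Qc: "Q\<^sup>T \<in> carrier_mat (r + k) p" using Q by (auto simp: orth_frames_def)
    obtain v where v: "v \<in> carrier_vec p" "v \<noteq> 0\<^sub>v p" "Q\<^sup>T *\<^sub>v v = 0\<^sub>v (r + k)"
      using wide_kernel[OF Qc] Suc.prems by (metis Suc_le_lessD add_Suc_right)
    have nz: "vnorm v \<noteq> 0" using v vnorm_eq_0_iff by blast
    define w where "w = (1 / vnorm v) \<cdot>\<^sub>v v"
    have w: "w \<in> carrier_vec p" using v by (simp add: w_def)
    have "vnorm w = 1" using nz by (simp add: w_def vnorm_smult)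
    then have w1: "w \<bullet> w = 1" using vnorm_sq[of w] by simp
    have w0: "Q\<^sup>T *\<^sub>v w = 0\<^sub>v (r + k)" using v Qc by (auto simp: w_def mult_mat_vec[OF Qc])
    show ?case
      using orth_frame_append[OF Q(1) w w1 w0] Q(2) Suc.prems
      by (intro bexI[of _ "mat p (Suc (r+k)) (\<lambda>(i,j). if j < r + k then Q $$ (i,j) else w $ i)"]) auto
  qed
  from this[of "p - r"] orth_frame_dim_le[OF U] show ?thesis using that by auto
qed

text \<open>The columns of \<open>B\<close> are a maximal independent set of columns of \<open>A\<close>, and \<open>C\<close> holds the coefficients of all
columns of \<open>A\<close> with respect to it.\<close>

lemma rank_factorization:
  fixes A :: "real mat"
  assumes A: "A \<in> carrier_mat n nc"
  obtains B C where "B \<in> carrier_mat n (vec_space.rank n A)" "C \<in> carrier_mat (vec_space.rank n A) nc" "A = B * C"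
proof -
  interpret vec_space "TYPE(real)" n .
  have cA: "set (cols A) \<subseteq> carrier_vec n" using cols_dim A by blast
  have "lin_indpt {}" using finite_lin_indpt2[of "{}"] by auto
  then have "\<exists>S. finite S \<and> maximal S (\<lambda>T. T \<subseteq> set (cols A) \<and> lin_indpt T) \<and> {} \<subseteq> S"
    by (intro maximal_exists_superset[of "set (cols A)"]) auto
  then obtain S where S: "maximal S (\<lambda>T. T \<subseteq> set (cols A) \<and> lin_indpt T)" by blast
  have rk: "rank A = card S" using rank_card_indpt[OF A S] .
  have Sc: "S \<subseteq> set (cols A)" and Si: "lin_indpt S" using S by (auto simp: maximal_def)
  have Sv: "S \<subseteq> carrier_vec n" using Sc cA by auto
  have fS: "finite S" using Sc finite_subset by auto
  have insp: "c \<in> span S" if c: "c \<in> set (cols A)" for c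
  proof (rule ccontr)
    assume n: "c \<notin> span S"
    then have "c \<notin> S" using in_own_span[OF Sv] by auto
    moreover have "c \<in> carrier_vec n" using c cA by blast
    ultimately have "lin_indpt (S \<union> {c})"
      using lin_dep_iff_in_span[of S c] Sv Si n by simp
    moreover have "S \<union> {c} \<subseteq> set (cols A)" using Sc c by blast
    ultimately have "S \<union> {c} = S" using S unfolding maximal_def by blast
    then show False using \<open>c \<notin> S\<close> by blast
  qed
  obtain xs where xs: "set xs = S" "length xs = card S" "distinct xs"
    using fS by (metis distinct_card finite_distinct_list)
  have "\<exists>a. \<forall>i<n. c $ i = (\<Sum>k<card S. xs ! k $ i * a k)" if c: "c \<in> set (cols A)" for c
  proof -
    obtain a where a: "lincomb a S = c" using insp[OF c] finite_in_span[OF fS Sv] by blast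
    have "c $ i = (\<Sum>k<card S. xs ! k $ i * a (xs ! k))" if i: "i < n" for i
    proof -
      have "c $ i = (\<Sum>x\<in>S. a x * x $ i)" using lincomb_index[OF i Sv, of a] unfolding a .
      also have "\<dots> = (\<Sum>k<length xs. a (xs ! k) * xs ! k $ i)"
        by (rule sum.reindex_bij_betw[OF bij_betw_nth[OF xs(3) refl xs(1)[symmetric]], symmetric])
      finally show ?thesis unfolding xs(2) by (simp only: mult.commute)
    qed
    then show ?thesis by (intro exI[of _ "\<lambda>k. a (xs ! k)"]) blast
  qed
  then obtain a where a: "\<And>c i. c \<in> set (cols A) \<Longrightarrow> i < n \<Longrightarrow> c $ i = (\<Sum>k<card S. xs ! k $ i * a c k)"
    by metis
  let ?B = "mat n (card S) (\<lambda>(i,k). xs ! k $ i)"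
  let ?C = "mat (card S) nc (\<lambda>(k,j). a (col A j) k)"
  have "A = ?B * ?C"
  proof (rule eq_matI)
    fix i j assume "i < dim_row (?B * ?C)" "j < dim_col (?B * ?C)"
    then have ij: "i < n" "j < nc" by auto
    have "col A j \<in> set (cols A)" using ij A by (metis carrier_matD(2) cols_length cols_nth nth_mem)
    from a[OF this ij(1)] show "A $$ (i,j) = (?B * ?C) $$ (i,j)"
      using ij A by (simp add: scalar_prod_def atLeast0LessThan)
  qed (use A in auto)
  then show ?thesis using that[of ?B ?C] rk by simp
qed

text \<open>If \<open>M v\<close> were nonzero, then by symmetry it would be orthogonal to all columns of \<open>U\<close>, and together with
them give \<open>r + 1\<close> orthonormal vectors in the range of \<open>M\<close>. Through a factorization \<open>M = B C\<close> with inner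
dimension \<open>r\<close> these would be linearly dependent.\<close>

lemma eigenvectors_span_range:
  fixes M :: "real mat"
  assumes M: "M \<in> carrier_mat p p" "M\<^sup>T = M" "vec_space.rank p M = r"
    and U: "U \<in> orth_frames p r"
    and ev: "\<And>j. j < r \<Longrightarrow> M *\<^sub>v col U j = \<mu> j \<cdot>\<^sub>v col U j" "\<And>j. j < r \<Longrightarrow> \<mu> j \<noteq> 0"
    and v: "v \<in> carrier_vec p" "U\<^sup>T *\<^sub>v v = 0\<^sub>v r"
  shows "M *\<^sub>v v = 0\<^sub>v p"
proof (rule ccontr)
  assume nz: "M *\<^sub>v v \<noteq> 0\<^sub>v p"
  have Uc: "U \<in> carrier_mat p r" using U by (auto simp: orth_frames_def)
  have colU: "col U j \<in> carrier_vec p" if "j < r" for j using Uc that by auto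
  have Uv: "col U j \<bullet> v = 0" if "j < r" for j
  proof -
    have "(U\<^sup>T *\<^sub>v v) $ j = col U j \<bullet> v" using that Uc by simp
    then show ?thesis using v(2) that by simp
  qed
  let ?n = "vnorm (M *\<^sub>v v)"
  have n0: "?n \<noteq> 0" using nz vnorm_eq_0_iff[of "M *\<^sub>v v" p] M v by auto
  define w where "w = (1 / ?n) \<cdot>\<^sub>v (M *\<^sub>v v)"
  have w: "w \<in> carrier_vec p" using M v by (simp add: w_def)
  have "vnorm w = 1" using n0 by (simp add: w_def vnorm_smult)
  then have w1: "w \<bullet> w = 1" using vnorm_sq[of w] by simp
  have "U\<^sup>T *\<^sub>v w = 0\<^sub>v r"
  proof (rule eq_vecI)
    fix j assume "j < dim_vec (0\<^sub>v r :: real vec)"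
    then have j: "j < r" by simp
    have "col U j \<bullet> (M *\<^sub>v v) = (M *\<^sub>v col U j) \<bullet> v"
      using mult_mat_vec_adjoint[OF M(1) colU[OF j] v(1)] M(2) by simp
    also have "\<dots> = \<mu> j * (col U j \<bullet> v)" using ev(1)[OF j] colU[OF j] v(1) by simp
    finally have "col U j \<bullet> (M *\<^sub>v v) = 0" using Uv[OF j] by simp
    then have "col U j \<bullet> w = 0" using colU[OF j] M v by (simp add: w_def)
    then show "(U\<^sup>T *\<^sub>v w) $ j = 0\<^sub>v r $ j" using j Uc by simp
  qed (use Uc in auto)
  define X where "X = mat p (Suc r) (\<lambda>(i,j). if j < r then U $$ (i,j) else w $ i)"
  have X: "X \<in> orth_frames p (Suc r)" unfolding X_def by (rule orth_frame_append[OF U w w1]) fact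
  then have Xc: "X \<in> carrier_mat p (Suc r)" and XX: "X\<^sup>T * X = 1\<^sub>m (Suc r)" by (auto simp: orth_frames_def)
  \<comment> \<open>The columns of \<open>Y\<close> are preimages under \<open>M\<close> of the columns of \<open>X\<close>.\<close>
  define Y where "Y = mat p (Suc r) (\<lambda>(i,j). if j < r then U $$ (i,j) / \<mu> j else v $ i / ?n)"
  have Yc: "Y \<in> carrier_mat p (Suc r)" by (simp add: Y_def)
  have MY: "M * Y = X"
  proof (rule eq_matI)
    fix i j assume "i < dim_row X" "j < dim_col X"
    then have ij: "i < p" "j < Suc r" using Xc by auto
    show "(M * Y) $$ (i,j) = X $$ (i,j)"
    proof (cases "j < r")
      case True
      have "col Y j = (1 / \<mu> j) \<cdot>\<^sub>v col U j" using True Uc by (intro eq_vecI) (auto simp: Y_def)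
      then have "(M * Y) $$ (i,j) = (1 / \<mu> j) * (M *\<^sub>v col U j) $ i"
        using ij M Yc colU[OF True] by (simp add: scalar_prod_smult_distrib[of _ p])
      then show ?thesis using ev[OF True] True ij Uc by (simp add: X_def)
    next
      case False
      then have jr: "j = r" using ij by simp
      have "col Y r = (1 / ?n) \<cdot>\<^sub>v v" using v by (intro eq_vecI) (auto simp: Y_def)
      then show ?thesis using ij M Yc v jr by (simp add: X_def w_def scalar_prod_smult_distrib[of _ p])
    qed
  qed (use M Yc Xc in auto)
  obtain B C where BC: "B \<in> carrier_mat p r" "C \<in> carrier_mat r p" "M = B * C"
    using rank_factorization[OF M(1)] M(3) by metis
  obtain a where a: "a \<in> carrier_vec (Suc r)" "a \<noteq> 0\<^sub>v (Suc r)" "(C * Y) *\<^sub>v a = 0\<^sub>v r"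
    using wide_kernel[OF mult_carrier_mat[OF BC(2) Yc] lessI] by blast
  have "X *\<^sub>v a = B *\<^sub>v ((C * Y) *\<^sub>v a)"
    using BC Yc a by (simp add: MY[symmetric] assoc_mult_mat[of B p r C p Y "Suc r"]
      assoc_mult_mat_vec[of B p r "C * Y" "Suc r" a])
  also have "\<dots> = 0\<^sub>v p" using a BC by (auto intro!: eq_vecI simp: scalar_prod_def)
  finally have "X\<^sup>T *\<^sub>v (X *\<^sub>v a) = 0\<^sub>v (Suc r)" using Xc by (auto intro!: eq_vecI simp: scalar_prod_def)
  moreover have "X\<^sup>T *\<^sub>v (X *\<^sub>v a) = a"
    using Xc a(1) XX by (subst assoc_mult_mat_vec[of _ "Suc r" p _ "Suc r", symmetric]) auto
  ultimately show False using a by simp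
qed

section \<open>Singular values of a symmetric matrix of rank r\<close>

lemma eigenvectors_svd_sum:
  fixes M :: "real mat"
  assumes M: "M \<in> carrier_mat p p" "M\<^sup>T = M" "vec_space.rank p M = r"
    and U: "U \<in> orth_frames p r"
    and ev: "\<And>j. j < r \<Longrightarrow> M *\<^sub>v col U j = \<mu> j \<cdot>\<^sub>v col U j" "\<And>j. j < r \<Longrightarrow> \<mu> j \<noteq> 0"
    and Q: "Q \<in> orth_frames p p" "\<And>i j. i < p \<Longrightarrow> j < r \<Longrightarrow> Q $$ (i,j) = U $$ (i,j)"
  shows "M = svd_sum p Q (\<lambda>i. if i < r then \<mu> i else 0) Q" (is "_ = svd_sum p Q ?d Q")
proof -
  have Qc: "Q \<in> carrier_mat p p" using Q by (auto simp: orth_frames_def)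
  have Uc: "U \<in> carrier_mat p r" using U by (auto simp: orth_frames_def)
  have rp: "r \<le> p" using orth_frame_dim_le[OF U] .
  have MQ: "M *\<^sub>v col Q i = ?d i \<cdot>\<^sub>v col Q i" if i: "i < p" for i
  proof (cases "i < r")
    case True
    have "col Q i = col U i" using True Qc Uc Q(2) rp by (intro eq_vecI) auto
    then show ?thesis using ev(1) True by simp
  next
    case False
    have "U\<^sup>T *\<^sub>v col Q i = 0\<^sub>v r"
    proof (rule eq_vecI)
      fix j assume "j < dim_vec (0\<^sub>v r :: real vec)"
      then have j: "j < r" by simp
      have "(U\<^sup>T *\<^sub>v col Q i) $ j = (\<Sum>c<p. Q $$ (c,j) * Q $$ (c,i))"
        using Uc Qc j i rp Q(2) by (auto simp: scalar_prod_def atLeast0LessThan intro!: sum.cong)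
      then show "(U\<^sup>T *\<^sub>v col Q i) $ j = 0\<^sub>v r $ j"
        using orth_frames_cols[OF Q(1), of j i] i j rp False by auto
    qed (use Uc in auto)
    from eigenvectors_span_range[OF M U ev _ this] have "M *\<^sub>v col Q i = 0\<^sub>v p" using Qc i by auto
    then show ?thesis using False Qc i by (auto intro!: eq_vecI)
  qed
  have "M = M * svd_sum p Q (\<lambda>_. 1) Q" using svd_sum_complete[OF Q(1)] M by simp
  also have "\<dots> = svd_sum p Q ?d Q"
  proof (rule eq_matI)
    fix a b assume "a < dim_row (svd_sum p Q ?d Q)" "b < dim_col (svd_sum p Q ?d Q)"
    then have ab: "a < p" "b < p" using Qc by (auto simp: svd_sum_def)
    have "(M * svd_sum p Q (\<lambda>_. 1) Q) $$ (a,b) = (\<Sum>c<p. M $$ (a,c) * (\<Sum>i<p. Q $$ (c,i) * Q $$ (b,i)))"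
      using ab M Qc by (simp add: svd_sum_def scalar_prod_def atLeast0LessThan)
    also have "\<dots> = (\<Sum>i<p. \<Sum>c<p. M $$ (a,c) * Q $$ (c,i) * Q $$ (b,i))"
      by (subst sum.swap) (simp add: sum_distrib_left mult.assoc)
    also have "\<dots> = (\<Sum>i<p. (M *\<^sub>v col Q i) $ a * Q $$ (b,i))"
      using ab M Qc by (intro sum.cong refl) (simp add: scalar_prod_def atLeast0LessThan sum_distrib_right)
    also have "\<dots> = (\<Sum>i<p. ?d i * Q $$ (a,i) * Q $$ (b,i))"
      using ab Qc by (intro sum.cong refl) (simp add: MQ)
    finally show "(M * svd_sum p Q (\<lambda>_. 1) Q) $$ (a,b) = svd_sum p Q ?d Q $$ (a,b)"
      using ab Qc by (simp add: svd_sum_def)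
  qed (use M Qc in \<open>auto simp: svd_sum_def\<close>)
  finally show ?thesis .
qed

lemma proots_prod_linear_factors:
  fixes xs :: "real list"
  shows "proots (\<Prod>a\<leftarrow>xs. [:- a, 1:]) = mset xs"
proof (induction xs)
  case (Cons x xs)
  have "(\<Prod>a\<leftarrow>xs. [:- a, 1:]) \<noteq> (0 :: real poly)" by (auto simp: prod_list_zero_iff)
  then have "proots ([:- x, 1:] * (\<Prod>a\<leftarrow>xs. [:- a, 1:])) = add_mset x (mset xs)"
    using Cons by (subst proots_mult) (auto simp del: mult_pCons_left)
  then show ?case unfolding list.map prod_list.Cons mset.simps .
qed simp

lemma sing_vals_orthogonal_diag:
  assumes Q: "Q \<in> orth_frames p p"
  shows "sing_vals (svd_sum p Q d Q) = rev (sort (map (\<lambda>i. \<bar>d i\<bar>) [0..<p]))"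
proof -
  have Qc: "Q \<in> carrier_mat p p" and QQ: "Q\<^sup>T * Q = 1\<^sub>m p" using Q by (auto simp: orth_frames_def)
  have QQ': "Q * Q\<^sup>T = 1\<^sub>m p" using mat_mult_left_right_inverse[of "Q\<^sup>T" p Q] Qc QQ by simp
  define t where "t i = d i * d i" for i
  define D where "D = mat p p (\<lambda>(i,j). if i = j then t i else 0)"
  have Dc: "D \<in> carrier_mat p p" by (simp add: D_def)
  have "(svd_sum p Q d Q)\<^sup>T * svd_sum p Q d Q = svd_sum p Q t Q"
    unfolding transpose_svd_sum t_def[abs_def] using svd_sum_mult[OF Q le_refl le_refl] by simp
  also have "\<dots> = Q * D * Q\<^sup>T"
  proof (rule eq_matI)
    fix a b assume "a < dim_row (Q * D * Q\<^sup>T)" "b < dim_col (Q * D * Q\<^sup>T)"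
    then have ab: "a < p" "b < p" using Qc by auto
    have QD: "Q * D = mat p p (\<lambda>(a,i). t i * Q $$ (a,i))"
      using Qc by (intro eq_matI)
        (auto simp: D_def scalar_prod_def if_distrib[of "\<lambda>x. _ * x"] sum.delta cong: if_cong)
    show "svd_sum p Q t Q $$ (a,b) = (Q * D * Q\<^sup>T) $$ (a,b)"
      using ab Qc unfolding QD by (simp add: svd_sum_def scalar_prod_def atLeast0LessThan)
  qed (use Qc in \<open>auto simp: svd_sum_def\<close>)
  finally have e: "(svd_sum p Q d Q)\<^sup>T * svd_sum p Q d Q = Q * D * Q\<^sup>T" .
  have "similar_mat (Q * D * Q\<^sup>T) D"
    by (rule similar_matI[of _ _ Q "Q\<^sup>T" p]) (use Qc Dc QQ QQ' in auto)
  then have "char_poly (Q * D * Q\<^sup>T) = char_poly D" by (rule char_poly_similar)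
  also have "\<dots> = (\<Prod>a\<leftarrow>diag_mat D. [:- a, 1:])"
    by (rule char_poly_upper_triangular[OF Dc]) (auto simp: D_def upper_triangular_def)
  also have "diag_mat D = map t [0..<p]" by (auto simp: diag_mat_def D_def)
  finally have "image_mset sqrt (proots (char_poly (Q * D * Q\<^sup>T))) = mset (map (\<lambda>i. \<bar>d i\<bar>) [0..<p])"
    by (simp only: proots_prod_linear_factors) (simp add: t_def multiset.map_comp comp_def)
  then show ?thesis unfolding sing_vals_def e by (simp only: sorted_list_of_multiset_mset)
qed

text \<open>The \<open>p - r\<close> zeros come last in the decreasing list of singular values, so position \<open>r\<close> holds the smallest
of the \<open>\<bar>\<mu> i\<bar>\<close>.\<close>

lemma sing_val_rank:
  assumes Q: "Q \<in> orth_frames p p" and r: "1 \<le> r" "r \<le> p"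
  shows "sing_val r (svd_sum p Q (\<lambda>i. if i < r then \<mu> i else 0) Q) = Min ((\<lambda>i. \<bar>\<mu> i\<bar>) ` {..<r})"
proof -
  let ?ms = "map (\<lambda>i. \<bar>\<mu> i\<bar>) [0..<r]"
  let ?l = "map (\<lambda>i. \<bar>if i < r then \<mu> i else 0\<bar>) [0..<p]"
  have l: "?l = ?ms @ replicate (p - r) 0"
    using r by (intro nth_equalityI) (auto simp: nth_append)
  have "sort ?l = replicate (p - r) 0 @ sort ?ms"
    unfolding l by (rule properties_for_sort) (auto simp: sorted_append)
  then have "sing_val r (svd_sum p Q (\<lambda>i. if i < r then \<mu> i else 0) Q) = rev (sort ?ms) ! (r - 1)"
    unfolding sing_val_def sing_vals_orthogonal_diag[OF Q] using r by (simp add: nth_append)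
  also have "\<dots> = sort ?ms ! 0" using r by (simp add: rev_nth)
  also have "\<dots> = Min (set (sort ?ms))"
  proof (rule Min_eqI[symmetric])
    show "sort ?ms ! 0 \<in> set (sort ?ms)" using r by (intro nth_mem) simp
  next
    fix y assume "y \<in> set (sort ?ms)"
    then obtain i where "i < length (sort ?ms)" "y = sort ?ms ! i" by (metis in_set_conv_nth)
    then show "sort ?ms ! 0 \<le> y" by (simp only: sorted_nth_mono sorted_sort le0)
  qed simp
  also have "set (sort ?ms) = (\<lambda>i. \<bar>\<mu> i\<bar>) ` {..<r}" by (auto simp: atLeast0LessThan)
  finally show ?thesis .
qed

section \<open>Perturbation of the leading singular subspaces\<close>

text \<open>An operator and its adjoint have the same norm, stated for functions so that compositions of
projections need not be assembled into matrices.\<close>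

lemma adjoint_bound:
  assumes adj: "\<And>x y. x \<in> carrier_vec p \<Longrightarrow> y \<in> carrier_vec p \<Longrightarrow> x \<bullet> f y = g x \<bullet> y"
    and f: "\<And>x. x \<in> carrier_vec p \<Longrightarrow> f x \<in> carrier_vec p"
    and g: "\<And>x. x \<in> carrier_vec p \<Longrightarrow> g x \<in> carrier_vec p"
    and bound: "\<And>x. x \<in> carrier_vec p \<Longrightarrow> vnorm (f x) \<le> c * vnorm x" and v: "v \<in> carrier_vec p"
  shows "vnorm (g v) \<le> c * vnorm v"
proof (cases "vnorm (g v) = 0")
  case True
  then show ?thesis using bound[OF v] vnorm_nonneg[of "f v"] by linarith
next
  case False
  have "vnorm (g v) * vnorm (g v) = g v \<bullet> g v" using vnorm_sq[of "g v"] by (simp add: power2_eq_square)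
  also have "\<dots> = v \<bullet> f (g v)" using adj v g by simp
  also have "\<dots> \<le> vnorm v * vnorm (f (g v))"
    using scalar_prod_le_vnorm[of v p "f (g v)"] v f g by fastforce
  also have "\<dots> \<le> vnorm v * (c * vnorm (g v))"
    using bound[OF g[OF v]] by (intro mult_left_mono) auto
  finally have "vnorm (g v) * vnorm (g v) \<le> (c * vnorm v) * vnorm (g v)" by (simp add: mult_ac)
  moreover have "0 < vnorm (g v)" using False vnorm_nonneg[of "g v"] by linarith
  ultimately show ?thesis by simp
qed

text \<open>The setting of one step: \<open>M\<close> has rank \<open>r\<close> and nonzero eigenvalues of modulus at least \<open>lam\<close>, and \<open>A\<close> is a
perturbation of \<open>M\<close> by a matrix of norm at most \<open>K\<close>, with an arbitrary singular value decomposition.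
Below, \<open>P\<close>, \<open>H\<close> and \<open>G\<close> project onto the range of \<open>M\<close> and onto the leading \<open>r\<close> left and right singular
vectors of \<open>A\<close>, and \<open>Y\<close> is the pseudo-inverse of \<open>M\<close>. When singular values of \<open>A\<close> coincide, \<open>H\<close> and \<open>G\<close>
may differ even for a symmetric \<open>A\<close> (with two opposite eigenvalues, say); \<open>H A = A G\<close> is the relation
between them that always holds.\<close>

locale perturbed_svd =
  fixes p r :: nat and U M E A L R :: "real mat" and \<mu> s :: "nat \<Rightarrow> real" and lam K :: real
  assumes r: "1 \<le> r" and U: "U \<in> orth_frames p r"
    and M: "M = svd_sum r U \<mu> U" and mu: "\<And>j. j < r \<Longrightarrow> lam \<le> \<bar>\<mu> j\<bar>" and lam: "0 < lam"
    and E: "E \<in> carrier_mat p p"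
    and E_bound: "\<And>v. v \<in> carrier_vec p \<Longrightarrow> vnorm (E *\<^sub>v v) \<le> K * vnorm v"
    and A: "A = M + E" and svd: "is_svd p A L s R"
begin

lemma rp: "r \<le> p" using orth_frame_dim_le[OF U] .

lemma L: "L \<in> orth_frames p p" and R: "R \<in> orth_frames p p" and s_nonneg: "i < p \<Longrightarrow> 0 \<le> s i"
  and s_mono: "i \<le> j \<Longrightarrow> j < p \<Longrightarrow> s j \<le> s i" and A_svd: "A = svd_sum p L s R"
  using svd by (auto simp: is_svd_def)

lemma dims [simp]: "dim_row U = p" "dim_col U = r" "dim_row L = p" "dim_col L = p" "dim_row R = p" "dim_col R = p"
  using U L R by (auto simp: orth_frames_def)

sublocale PU: frame_projection p r r U using U by unfold_locales auto
sublocale PL: frame_projection p p r L using L rp by unfold_locales auto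
sublocale PR: frame_projection p p r R using R rp by unfold_locales auto

abbreviation "P v \<equiv> frame_proj r U *\<^sub>v v"
abbreviation "H v \<equiv> frame_proj r L *\<^sub>v v"
abbreviation "G v \<equiv> frame_proj r R *\<^sub>v v"
abbreviation "Y v \<equiv> svd_sum r U (\<lambda>i. 1 / \<mu> i) U *\<^sub>v v"

lemma M_carr [simp]: "M \<in> carrier_mat p p" unfolding M by (simp add: svd_sum_def)

lemma A_carr [simp]: "A \<in> carrier_mat p p" unfolding A using E by simp

lemma dim_MEA [simp]: "dim_row M = p" "dim_col M = p" "dim_row E = p" "dim_col E = p" "dim_row A = p" "dim_col A = p"
  using M_carr E A_carr carrier_matD by blast+

lemma Mv [simp]: "v \<in> carrier_vec p \<Longrightarrow> M *\<^sub>v v \<in> carrier_vec p" using mult_mat_vec_carrier[OF M_carr] .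

lemma Ev [simp]: "v \<in> carrier_vec p \<Longrightarrow> E *\<^sub>v v \<in> carrier_vec p" using mult_mat_vec_carrier[OF E] .

lemma Av [simp]: "v \<in> carrier_vec p \<Longrightarrow> A *\<^sub>v v \<in> carrier_vec p" using mult_mat_vec_carrier[OF A_carr] .

lemma Yv [simp]: "v \<in> carrier_vec p \<Longrightarrow> Y v \<in> carrier_vec p"
  by (rule mult_mat_vec_carrier[of _ p p]) (auto simp: svd_sum_def)

lemma A_vec: "v \<in> carrier_vec p \<Longrightarrow> A *\<^sub>v v = M *\<^sub>v v + E *\<^sub>v v"
  unfolding A by (rule add_mult_distrib_mat_vec[OF M_carr E])

lemma H_A: "v \<in> carrier_vec p \<Longrightarrow> H (A *\<^sub>v v) = A *\<^sub>v (G v)"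
  and H_A_svd: "v \<in> carrier_vec p \<Longrightarrow> H (A *\<^sub>v v) = svd_sum r L s R *\<^sub>v v"
  unfolding A_svd frame_proj_def using rp
  by (simp_all add: svd_sum_mult_vec[OF L] svd_sum_mult_vec[OF R] min_absorb1 min_absorb2)

lemma P_M: "v \<in> carrier_vec p \<Longrightarrow> P (M *\<^sub>v v) = M *\<^sub>v v"
  and M_P: "v \<in> carrier_vec p \<Longrightarrow> M *\<^sub>v (P v) = M *\<^sub>v v"
  unfolding M frame_proj_def by (simp_all add: svd_sum_mult_vec[OF U])

lemma mu_nz: "j < r \<Longrightarrow> \<mu> j \<noteq> 0" using mu[of j] lam by auto

lemma M_Y: "v \<in> carrier_vec p \<Longrightarrow> M *\<^sub>v Y v = P v"
proof -
  assume v: "v \<in> carrier_vec p"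
  have "svd_sum r U (\<lambda>i. \<mu> i * (1 / \<mu> i)) U = svd_sum r U (\<lambda>_. 1) U"
    using mu_nz by (intro svd_sum_cong) auto
  then show ?thesis unfolding M frame_proj_def using v by (simp add: svd_sum_mult_vec[OF U])
qed

lemma norm_P: "v \<in> carrier_vec p \<Longrightarrow> (vnorm (P v))\<^sup>2 = (\<Sum>i<r. (col U i \<bullet> v)\<^sup>2)"
  unfolding frame_proj_def by (simp add: vnorm_svd_sum[OF U])

lemma Y_bound: 
  assumes v: "v \<in> carrier_vec p"
  shows "vnorm (Y v) \<le> vnorm v / lam"
proof -
  have "(vnorm (Y v))\<^sup>2 = (\<Sum>i<r. (1 / \<mu> i)\<^sup>2 * (col U i \<bullet> v)\<^sup>2)"
    using v by (simp add: vnorm_svd_sum[OF U])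
  also have "\<dots> \<le> (\<Sum>i<r. (1 / lam)\<^sup>2 * (col U i \<bullet> v)\<^sup>2)"
  proof (intro sum_mono mult_right_mono)
    fix i assume "i \<in> {..<r}"
    then have "\<bar>1 / \<mu> i\<bar> \<le> 1 / lam" using mu[of i] lam by (simp add: frac_le)
    then show "(1 / \<mu> i)\<^sup>2 \<le> (1 / lam)\<^sup>2" by (simp add: abs_le_square_iff[symmetric] lam less_imp_le)
  qed simp
  also have "\<dots> = (1 / lam * vnorm (P v))\<^sup>2"
    unfolding power_mult_distrib norm_P[OF v] by (rule sum_distrib_left[symmetric])
  finally have "vnorm (Y v) \<le> 1 / lam * vnorm (P v)"
    by (rule power2_le_imp_le) (simp add: lam less_imp_le)
  also have "\<dots> \<le> 1 / lam * vnorm v"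
    using PU.contraction[OF v] lam by (intro mult_left_mono) auto
  finally show ?thesis by simp
qed

lemma M_lower:
  assumes v: "v \<in> carrier_vec p"
  shows "lam * vnorm (P v) \<le> vnorm (M *\<^sub>v v)"
proof -
  have "(lam * vnorm (P v))\<^sup>2 = (\<Sum>i<r. lam\<^sup>2 * (col U i \<bullet> v)\<^sup>2)"
    using norm_P[OF v] by (simp add: sum_distrib_left power_mult_distrib)
  also have "\<dots> \<le> (\<Sum>i<r. (\<mu> i)\<^sup>2 * (col U i \<bullet> v)\<^sup>2)"
    using mu lam by (intro sum_mono mult_right_mono) (auto simp: abs_le_square_iff[symmetric])
  also have "\<dots> = (vnorm (M *\<^sub>v v))\<^sup>2" unfolding M using v by (simp add: vnorm_svd_sum[OF U])
  finally show ?thesis by (rule power2_le_imp_le) simp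
qed

lemma norm_A: "v \<in> carrier_vec p \<Longrightarrow> (vnorm (A *\<^sub>v v))\<^sup>2 = (\<Sum>i<p. (s i)\<^sup>2 * (col R i \<bullet> v)\<^sup>2)"
  unfolding A_svd by (simp add: vnorm_svd_sum[OF L])

lemma norm_R: "v \<in> carrier_vec p \<Longrightarrow> (vnorm v)\<^sup>2 = (\<Sum>i<p. (col R i \<bullet> v)\<^sup>2)"
  using vnorm_svd_sum[OF R le_refl, of R v "\<lambda>_. 1"] svd_sum_complete[OF R] by simp

text \<open>Weyl's inequality, by its usual proof: some nonzero \<open>v\<close> in the range of \<open>M\<close> is orthogonal to the first
\<open>r - 1\<close> right singular vectors of \<open>A\<close>. Indices of \<open>s\<close> start at \<open>0\<close>.\<close>

lemma sing_val_r_ge: "lam - K \<le> s (r - 1)"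
proof -
  let ?B = "mat (r - 1) p (\<lambda>(i,j). R $$ (j,i))"
  obtain v where v: "v \<in> carrier_vec p" "v \<noteq> 0\<^sub>v p" "P v = v" "?B *\<^sub>v v = 0\<^sub>v (r - 1)"
    using r by (rule_tac frame_meets_kernel[OF U, of ?B "r - 1"]) auto
  note Pv = v(3)
  have z: "col R i \<bullet> v = 0" if "i < r - 1" for i
  proof -
    have "(?B *\<^sub>v v) $ i = col R i \<bullet> v" using that v(1) rp by (auto simp: scalar_prod_def intro!: sum.cong)
    then have "0\<^sub>v (r - 1) $ i = col R i \<bullet> v" unfolding v(4) .
    then show ?thesis using that by simp
  qed
  have "(vnorm (A *\<^sub>v v))\<^sup>2 \<le> (\<Sum>i<p. (s (r - 1))\<^sup>2 * (col R i \<bullet> v)\<^sup>2)"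
    unfolding norm_A[OF v(1)]
  proof (rule sum_mono)
    fix i assume i: "i \<in> {..<p}"
    show "(s i)\<^sup>2 * (col R i \<bullet> v)\<^sup>2 \<le> (s (r - 1))\<^sup>2 * (col R i \<bullet> v)\<^sup>2"
      using z[of i] s_mono[of "r - 1" i] s_nonneg[of i] i
      by (cases "i < r - 1") (auto intro!: mult_right_mono power_mono)
  qed
  also have "\<dots> = (s (r - 1) * vnorm v)\<^sup>2" using norm_R[OF v(1)] by (simp add: sum_distrib_left power_mult_distrib)
  finally have "vnorm (A *\<^sub>v v) \<le> s (r - 1) * vnorm v"
    by (rule power2_le_imp_le) (use s_nonneg[of "r - 1"] r rp in auto)
  moreover have "lam * vnorm v \<le> vnorm (A *\<^sub>v v) + K * vnorm v"
  proof -
    have "M *\<^sub>v v = A *\<^sub>v v - E *\<^sub>v v" using v(1) by (auto simp: A_vec intro!: eq_vecI)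
    then have "vnorm (M *\<^sub>v v) \<le> vnorm (A *\<^sub>v v) + vnorm (E *\<^sub>v v)" using v(1) by (simp add: vnorm_diff_le[of _ p])
    then show ?thesis using M_lower[OF v(1)] E_bound[OF v(1)] Pv by simp
  qed
  ultimately have "(lam - K) * vnorm v \<le> s (r - 1) * vnorm v" by (simp add: algebra_simps)
  moreover have "0 < vnorm v" using v vnorm_eq_0_iff[OF v(1)] vnorm_nonneg[of v] by linarith
  ultimately show ?thesis by simp
qed

text \<open>The other half of Weyl's inequality: some nonzero combination \<open>v\<close> of the first \<open>r + 1\<close> right singular
vectors lies in the kernel of \<open>M\<close>, and there \<open>A\<close> and \<open>E\<close> agree.\<close>

lemma sing_val_Suc_r_le:
  assumes rp: "r < p"
  shows "s r \<le> K"
proof -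
  have R': "mat p (Suc r) (\<lambda>(i,j). R $$ (i,j)) \<in> orth_frames p (Suc r)"
    using orth_frames_cols[OF R] rp by (intro orth_framesI) auto
  have U': "U\<^sup>T \<in> carrier_mat r p" by (simp add: carrier_matI)
  obtain v where v: "v \<in> carrier_vec p" "v \<noteq> 0\<^sub>v p"
    "frame_proj (Suc r) (mat p (Suc r) (\<lambda>(i,j). R $$ (i,j))) *\<^sub>v v = v" "U\<^sup>T *\<^sub>v v = 0\<^sub>v r"
    by (rule frame_meets_kernel[OF R' U' lessI])
  have "frame_proj (Suc r) (mat p (Suc r) (\<lambda>(i,j). R $$ (i,j))) = svd_sum (Suc r) R (\<lambda>_. 1) R"
    by (intro eq_matI) (auto simp: frame_proj_def svd_sum_def)
  then have "(vnorm v)\<^sup>2 = (vnorm (svd_sum (Suc r) R (\<lambda>_. 1) R *\<^sub>v v))\<^sup>2" using v(3) by simp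
  also have "\<dots> = (\<Sum>i<Suc r. (col R i \<bullet> v)\<^sup>2)" using vnorm_svd_sum[OF R, of "Suc r" R v] rp v(1) by simp
  finally have nv: "(vnorm v)\<^sup>2 = (\<Sum>i<Suc r. (col R i \<bullet> v)\<^sup>2)" .
  have "col U i \<bullet> v = 0" if "i < r" for i
  proof -
    have "(U\<^sup>T *\<^sub>v v) $ i = col U i \<bullet> v" using that by simp
    then show ?thesis using v(4) that by simp
  qed
  then have "vnorm (M *\<^sub>v v) = 0"
    using vnorm_svd_sum[OF U, of r U v \<mu>] v(1) unfolding M by simp
  then have "M *\<^sub>v v = 0\<^sub>v p" using vnorm_eq_0_iff[of "M *\<^sub>v v" p] v(1) by simp
  then have AE: "A *\<^sub>v v = E *\<^sub>v v" using v(1) by (simp add: A_vec)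
  have "(s r * vnorm v)\<^sup>2 = (\<Sum>i<Suc r. (s r)\<^sup>2 * (col R i \<bullet> v)\<^sup>2)"
    unfolding power_mult_distrib nv by (rule sum_distrib_left)
  also have "\<dots> \<le> (\<Sum>i<Suc r. (s i)\<^sup>2 * (col R i \<bullet> v)\<^sup>2)"
    using s_mono s_nonneg rp by (intro sum_mono mult_right_mono power_mono) auto
  also have "\<dots> \<le> (\<Sum>i<p. (s i)\<^sup>2 * (col R i \<bullet> v)\<^sup>2)"
    using rp by (intro sum_mono2) auto
  also have "\<dots> = (vnorm (E *\<^sub>v v))\<^sup>2" using norm_A[OF v(1)] AE by simp
  finally have "s r * vnorm v \<le> vnorm (E *\<^sub>v v)" by (rule power2_le_imp_le) simp
  also have "\<dots> \<le> K * vnorm v" by (rule E_bound[OF v(1)])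
  finally have "s r * vnorm v \<le> K * vnorm v" .
  moreover have "0 < vnorm v" using v vnorm_eq_0_iff[OF v(1)] vnorm_nonneg[of v] by linarith
  ultimately show ?thesis by simp
qed

lemma A_minus_H_A:
  assumes v: "v \<in> carrier_vec p"
  shows "vnorm (A *\<^sub>v v - H (A *\<^sub>v v)) \<le> K * vnorm v"
proof -
  have K: "0 \<le> K * vnorm v" using E_bound[OF v] vnorm_nonneg order.trans by blast
  let ?t = "\<lambda>i. if i < r then 0 else s i"
  have "A *\<^sub>v v - H (A *\<^sub>v v) = svd_sum p L ?t R *\<^sub>v v"
  proof -
    have "svd_sum p L s R = svd_sum p L ?t R + svd_sum r L s R"
    proof (rule eq_matI)
      fix a b assume "a < dim_row (svd_sum p L ?t R + svd_sum r L s R)" "b < dim_col (svd_sum p L ?t R + svd_sum r L s R)"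
      then have ab: "a < p" "b < p" by (auto simp: svd_sum_def)
      have "(\<Sum>i<p. s i * L $$ (a,i) * R $$ (b,i)) =
          (\<Sum>i<p. ?t i * L $$ (a,i) * R $$ (b,i)) + (\<Sum>i<p. if i < r then s i * L $$ (a,i) * R $$ (b,i) else 0)"
        unfolding sum.distrib[symmetric] by (intro sum.cong refl) simp
      also have "(\<Sum>i<p. if i < r then s i * L $$ (a,i) * R $$ (b,i) else 0) = (\<Sum>i<r. s i * L $$ (a,i) * R $$ (b,i))"
        using rp by (subst sum.inter_filter[symmetric]) (auto intro!: sum.cong)
      finally show "svd_sum p L s R $$ (a,b) = (svd_sum p L ?t R + svd_sum r L s R) $$ (a,b)"
        using ab by (simp add: svd_sum_def)
    qed (auto simp: svd_sum_def)
    then have "A *\<^sub>v v = svd_sum p L ?t R *\<^sub>v v + svd_sum r L s R *\<^sub>v v"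
      unfolding A_svd using v by (simp add: add_mult_distrib_mat_vec[of _ p p] svd_sum_def)
    then show ?thesis unfolding H_A_svd[OF v]
      by (auto intro!: eq_vecI simp: svd_sum_def)
  qed
  then have "(vnorm (A *\<^sub>v v - H (A *\<^sub>v v)))\<^sup>2 = (\<Sum>i<p. (?t i)\<^sup>2 * (col R i \<bullet> v)\<^sup>2)"
    using v by (simp add: vnorm_svd_sum[OF L] cong: if_cong)
  also have "\<dots> \<le> (\<Sum>i<p. K\<^sup>2 * (col R i \<bullet> v)\<^sup>2)"
  proof (intro sum_mono mult_right_mono)
    fix i assume i: "i \<in> {..<p}"
    show "(?t i)\<^sup>2 \<le> K\<^sup>2"
    proof (cases "i < r")
      case False
      then have "s i \<le> K" using s_mono[of r i] sing_val_Suc_r_le i by auto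
      then show ?thesis using s_nonneg[of i] i False by (auto intro!: power_mono)
    qed simp
  qed simp
  also have "\<dots> = (K * vnorm v)\<^sup>2" unfolding power_mult_distrib norm_R[OF v] by (rule sum_distrib_left[symmetric])
  finally show ?thesis by (rule power2_le_imp_le) (rule K)
qed

lemma K_nonneg: "0 \<le> K"
proof -
  have "p \<noteq> 0" using r rp by simp
  have "unit_vec p 0 \<in> carrier_vec p" by simp
  from E_bound[OF this] have "0 \<le> K * vnorm (unit_vec p 0)" using vnorm_nonneg order.trans by blast
  moreover have "(vnorm (unit_vec p 0))\<^sup>2 = 1" using \<open>p \<noteq> 0\<close> by (simp add: vnorm_sq)
  then have "vnorm (unit_vec p 0) = 1" using vnorm_nonneg[of "unit_vec p 0"] by (simp add: power2_eq_1_iff)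
  ultimately show ?thesis by simp
qed

lemma M_minus_H_M:
  assumes v: "v \<in> carrier_vec p"
  shows "vnorm (M *\<^sub>v v - H (M *\<^sub>v v)) \<le> 2 * K * vnorm v"
proof -
  have "M *\<^sub>v v - H (M *\<^sub>v v) = (A *\<^sub>v v - H (A *\<^sub>v v)) - (E *\<^sub>v v - H (E *\<^sub>v v))"
  proof -
    have "H (A *\<^sub>v v) = H (M *\<^sub>v v) + H (E *\<^sub>v v)" using v by (simp add: A_vec PL.add)
    then show ?thesis using v A_vec[OF v] by (intro eq_vecI) (auto simp: carrier_vecD[OF Mv] carrier_vecD[OF Ev])
  qed
  then have "vnorm (M *\<^sub>v v - H (M *\<^sub>v v)) \<le> vnorm (A *\<^sub>v v - H (A *\<^sub>v v)) + vnorm (E *\<^sub>v v - H (E *\<^sub>v v))"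
    using v by (simp add: vnorm_diff_le[of _ p])
  also have "\<dots> \<le> K * vnorm v + K * vnorm v"
    using A_minus_H_A[OF v] PL.co_contraction[OF Ev[OF v]] E_bound[OF v] by simp
  finally show ?thesis by simp
qed

text \<open>Vectors in the range of \<open>M\<close> have the form \<open>M (Y v)\<close>, and \<open>(1 - H) M = (1 - H) A - (1 - H) E\<close>, where both
summands have norm at most \<open>K\<close>.\<close>

lemma sin_theta_le:
  assumes v: "v \<in> carrier_vec p"
  shows "vnorm (P v - H (P v)) \<le> 2 * K / lam * vnorm v"
proof -
  have "vnorm (P v - H (P v)) \<le> 2 * K * vnorm (Y v)"
    using M_minus_H_M[OF Yv[OF v]] by (simp add: M_Y[OF v])
  also have "\<dots> \<le> 2 * K * (vnorm v / lam)"
    using Y_bound[OF v] K_nonneg by (intro mult_left_mono) auto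
  finally show ?thesis by simp
qed

text \<open>Wedin's argument, with \<open>A\<close> now in the role of \<open>M\<close>: by Weyl's inequality the truncation \<open>H A\<close> has a
pseudo-inverse of norm at most \<open>1 / (lam - K)\<close>.\<close>

lemma co_sin_theta_le:
  assumes v: "v \<in> carrier_vec p" and Kl: "K < lam"
  shows "vnorm (H v - P (H v)) \<le> K / (lam - K) * vnorm v"
proof -
  have sm: "lam - K \<le> s i" if "i < r" for i
  proof -
    have "s (r - 1) \<le> s i" using that rp by (intro s_mono) auto
    then show ?thesis using sing_val_r_ge by linarith
  qed
  have s: "0 < s i" if "i < r" for i
    using sm[OF that] Kl by linarith
  \<comment> \<open>\<open>H v\<close> has the preimage \<open>g\<close> under \<open>A\<close>, which is short because the first \<open>r\<close> singular values are
      large; \<open>1 - P\<close> kills the part \<open>M g\<close> of \<open>A g\<close>.\<close>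
  define g where "g = svd_sum r R (\<lambda>i. 1 / s i) L *\<^sub>v v"
  have g: "g \<in> carrier_vec p" unfolding g_def using v by (intro mult_mat_vec_carrier[of _ p p]) (auto simp: svd_sum_def)
  have "A *\<^sub>v g = svd_sum r L (\<lambda>i. s i * (1 / s i)) L *\<^sub>v v"
    unfolding A_svd g_def using rp v by (simp add: svd_sum_mult_vec[OF R] min_absorb2)
  also have "svd_sum r L (\<lambda>i. s i * (1 / s i)) L = svd_sum r L (\<lambda>_. 1) L"
    by (rule svd_sum_cong) (use s in force)
  finally have Ag: "A *\<^sub>v g = H v" by (simp add: frame_proj_def)
  have "(vnorm g)\<^sup>2 = (\<Sum>i<r. (1 / s i)\<^sup>2 * (col L i \<bullet> v)\<^sup>2)"
    unfolding g_def using v rp by (simp add: vnorm_svd_sum[OF R])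
  also have "\<dots> \<le> (\<Sum>i<r. (1 / (lam - K))\<^sup>2 * (col L i \<bullet> v)\<^sup>2)"
  proof (intro sum_mono mult_right_mono power_mono)
    fix i assume "i \<in> {..<r}"
    then show "1 / s i \<le> 1 / (lam - K)" "0 \<le> 1 / s i" using s[of i] sm[of i] Kl by (auto simp: frac_le)
  qed simp
  also have "\<dots> = (1 / (lam - K))\<^sup>2 * (vnorm (H v))\<^sup>2"
    unfolding frame_proj_def using v rp by (simp add: vnorm_svd_sum[OF L] sum_distrib_left)
  also have "\<dots> \<le> (1 / (lam - K))\<^sup>2 * (vnorm v)\<^sup>2"
    using PL.contraction[OF v] by (intro mult_left_mono power_mono) auto
  finally have "(vnorm g)\<^sup>2 \<le> (1 / (lam - K) * vnorm v)\<^sup>2" by (simp only: power_mult_distrib)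
  then have ng: "vnorm g \<le> 1 / (lam - K) * vnorm v"
    by (rule power2_le_imp_le) (use Kl in simp)
  have "H v - P (H v) = E *\<^sub>v g - P (E *\<^sub>v g)"
    unfolding Ag[symmetric] using g
    by (intro eq_vecI) (auto simp: A_vec PU.add P_M carrier_vecD[OF Mv] carrier_vecD[OF Ev])
  then have "vnorm (H v - P (H v)) \<le> K * vnorm g"
    using PU.co_contraction[OF Ev[OF g]] E_bound[OF g] by simp
  also have "\<dots> \<le> K * (1 / (lam - K) * vnorm v)" using ng K_nonneg by (intro mult_left_mono) auto
  finally show ?thesis by simp
qed

text \<open>For one principal angle \<open>\<theta>\<close> the operator \<open>(1 - P) H P\<close> acts as \<open>sin \<theta> cos \<theta>\<close>, so this is a form of the
Davis-Kahan theorem for the double angle. It comes from \<open>H A = A G\<close>: multiplication by \<open>1 - P\<close> removes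
\<open>M G\<close> and leaves \<open>(1 - P) H M = (1 - P) (E G - H E)\<close>. The norm of \<open>E G - H E\<close> is at most \<open>K\<close> and not
only \<open>2 K\<close>, because \<open>E G - H E = (1 - H) E G - H E (1 - G)\<close>, where the two terms have orthogonal ranges
and act on orthogonal components of the argument.\<close>

lemma sin_two_theta_le:
  assumes v: "v \<in> carrier_vec p"
  shows "vnorm (H (P v) - P (H (P v))) \<le> K / lam * vnorm v"
proof -
  define w where "w = Y v"
  have w: "w \<in> carrier_vec p" using v by (simp add: w_def)
  have Mw: "M *\<^sub>v w = P v" using v by (simp add: w_def M_Y)
  define a where "a = E *\<^sub>v (G w)"
  define b where "b = H (E *\<^sub>v w)"
  have a: "a \<in> carrier_vec p" and b: "b \<in> carrier_vec p" using w by (auto simp: a_def b_def)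
  have "H (M *\<^sub>v w) + b = M *\<^sub>v (G w) + a"
    using H_A[OF w] w by (simp add: A_vec PL.add a_def b_def)
  then have "H (M *\<^sub>v w) = M *\<^sub>v (G w) + (a - b)"
  proof -
    assume e: "H (M *\<^sub>v w) + b = M *\<^sub>v (G w) + a"
    have "H (M *\<^sub>v w) = (H (M *\<^sub>v w) + b) - b" using w b by (intro eq_vecI) auto
    also have "\<dots> = M *\<^sub>v (G w) + (a - b)" unfolding e using a b by (intro eq_vecI) auto
    finally show ?thesis .
  qed
  then have "H (P v) - P (H (P v)) = (a - b) - P (a - b)"
    unfolding Mw[symmetric] using w a b
    by (intro eq_vecI) (auto simp: PU.add P_M carrier_vecD[OF Mv] carrier_vecD[OF PU.vec_carr])
  then have 1: "vnorm (H (P v) - P (H (P v))) \<le> vnorm (a - b)"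
    using PU.co_contraction[of "a - b"] a b by simp
  have Hb: "H b = b" using w by (simp add: b_def PL.idem)
  have "(a - b) - H (a - b) = a - H a"
    using a b by (intro eq_vecI) (auto simp: PL.minus Hb carrier_vecD[OF PL.vec_carr])
  then have 2: "vnorm ((a - b) - H (a - b)) \<le> K * vnorm (G w)"
    using PL.co_contraction[OF a] E_bound[of "G w"] w by (simp add: a_def)
  have "H (a - b) = - H (E *\<^sub>v (w - G w))"
    using a b w by (intro eq_vecI)
      (auto simp: PL.minus Hb mult_minus_distrib_mat_vec[OF E] a_def b_def carrier_vecD[OF PL.vec_carr] PL.idem)
  then have "vnorm (H (a - b)) \<le> vnorm (E *\<^sub>v (w - G w))"
    using PL.contraction[of "E *\<^sub>v (w - G w)"] w by (simp add: vnorm_uminus)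
  then have 3: "vnorm (H (a - b)) \<le> K * vnorm (w - G w)"
    using E_bound[of "w - G w"] w by simp
  have "(vnorm (a - b))\<^sup>2 = (vnorm (H (a - b)))\<^sup>2 + (vnorm ((a - b) - H (a - b)))\<^sup>2"
    using a b by (intro PL.pythagoras) simp
  also have "\<dots> \<le> (K * vnorm (w - G w))\<^sup>2 + (K * vnorm (G w))\<^sup>2"
    using 2 3 by (intro add_mono power_mono) auto
  also have "\<dots> = (K * vnorm w)\<^sup>2"
    using PR.pythagoras[OF w] by (simp add: power_mult_distrib distrib_left)
  finally have "vnorm (a - b) \<le> K * vnorm w"
    by (rule power2_le_imp_le) (use K_nonneg in simp)
  also have "\<dots> \<le> K * (vnorm v / lam)"
    using Y_bound[OF v] K_nonneg unfolding w_def by (intro mult_left_mono) auto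
  finally show ?thesis using 1 by simp
qed

text \<open>Let \<open>y\<close> be the norm of \<open>H (1 - P)\<close>, attained at \<open>x\<close>, and \<open>g = H (x - P x)\<close>. By the double-angle bound
\<open>\<parallel>P g\<parallel> \<le> K / lam\<close>, and \<open>\<parallel>g - P g\<parallel> \<le> y\<^sup>2\<close> since \<open>(1 - P) H\<close> also has norm \<open>y\<close>. So Pythagoras gives
\<open>y\<^sup>2 - y\<^sup>4 \<le> (K / lam)\<^sup>2\<close>. As \<open>K / lam\<close> is at most about \<open>5/12\<close>, the right-hand side is below
\<open>(12/25)\<^sup>2 (1 - (12/25)\<^sup>2)\<close>, and \<open>y\<^sup>2\<close> cannot lie between \<open>(12/25)\<^sup>2\<close> and \<open>1 - (12/25)\<^sup>2\<close>.
The summand \<open>1/1000\<close> leaves room for the diagonal error at time \<open>0\<close>.\<close>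

lemma leakage_le:
  assumes K: "K \<le> (5/12 + 1/1000) * lam" and v: "v \<in> carrier_vec p"
  shows "vnorm (H (v - P v)) \<le> 12/25 * vnorm v"
proof -
  have p0: "0 < p" using r rp by simp
  define B where "B = frame_proj r L * (1\<^sub>m p - frame_proj r U)"
  have Bc: "B \<in> carrier_mat p p"
    unfolding B_def by (intro mult_carrier_mat[OF PL.carr] minus_carrier_mat) simp
  have B: "B *\<^sub>v x = H (x - P x)" if "x \<in> carrier_vec p" for x
    unfolding B_def using that
    by (subst assoc_mult_mat_vec[of _ p p _ p])
      (auto simp: minus_mult_distrib_mat_vec[of _ p p] intro!: minus_carrier_mat)
  obtain x where x: "x \<in> carrier_vec p" "vnorm x = 1" "vnorm (B *\<^sub>v x) = spec_norm B"
    and Bb: "\<And>w. w \<in> carrier_vec p \<Longrightarrow> vnorm (B *\<^sub>v w) \<le> spec_norm B * vnorm w"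
    using spec_norm_attained[OF Bc p0] by blast
  define y where "y = spec_norm B"
  define k where "k = K / lam"
  have k0: "0 \<le> k" and k1: "k \<le> 5/12 + 1/1000" using K K_nonneg lam by (auto simp: k_def field_simps)
  have y0: "0 \<le> y" using x(3) vnorm_nonneg[of "B *\<^sub>v x"] by (simp add: y_def)
  \<comment> \<open>The bounds on \<open>(1 - P) H\<close> pass to its adjoint \<open>H (1 - P)\<close>. This first bound is far from
      \<open>12/25\<close>, but it is what excludes the upper branch of the quadratic inequality below.\<close>
  have "vnorm (H (x - P x)) \<le> K / (lam - K) * vnorm x"
  proof (rule adjoint_bound[where p = p and f = "\<lambda>v. H v - P (H v)"])
    fix x y :: "real vec" assume "x \<in> carrier_vec p" "y \<in> carrier_vec p"
    then show "x \<bullet> (H y - P (H y)) = H (x - P x) \<bullet> y"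
      by (simp add: PU.co_sym PL.sym)
  next
    have "K < lam" using K lam by auto
    then show "vnorm (H x - P (H x)) \<le> K / (lam - K) * vnorm x" if "x \<in> carrier_vec p" for x
      using co_sin_theta_le that by blast
  qed (use x in auto)
  then have "y \<le> K / (lam - K)" using x B[OF x(1)] by (simp add: y_def)
  also have "K / (lam - K) = k / (1 - k)" using lam by (simp add: k_def field_simps)
  also have "\<dots> \<le> 3/4" using k1 by (simp add: field_simps)
  finally have y34: "y \<le> 3/4" .
  define g where "g = B *\<^sub>v x"
  have g: "g \<in> carrier_vec p" using x Bc by (simp add: g_def)
  have gB: "g = H (x - P x)" using B x by (simp add: g_def)
  have Hg: "H g = g" using x unfolding gB by (simp add: PL.idem)
  have ng: "vnorm g = y" using x by (simp add: g_def y_def)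
  have "vnorm (P (H (x - P x))) \<le> K / lam * vnorm x"
  proof (rule adjoint_bound[where p = p and f = "\<lambda>v. H (P v) - P (H (P v))"])
    fix x y :: "real vec" assume "x \<in> carrier_vec p" "y \<in> carrier_vec p"
    then show "x \<bullet> (H (P y) - P (H (P y))) = P (H (x - P x)) \<bullet> y"
      by (simp add: PU.co_sym PL.sym PU.sym)
  qed (use x sin_two_theta_le in auto)
  then have 1: "vnorm (P g) \<le> k" using x by (simp add: gB k_def)
  have "vnorm (H g - P (H g)) \<le> y * vnorm g"
  proof (rule adjoint_bound[where p = p and f = "\<lambda>v. H (v - P v)"])
    fix x y :: "real vec" assume "x \<in> carrier_vec p" "y \<in> carrier_vec p"
    then show "x \<bullet> H (y - P y) = (H x - P (H x)) \<bullet> y"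
      by (simp add: PU.co_sym PL.sym)
  next
    show "vnorm (H (x - P x)) \<le> y * vnorm x" if "x \<in> carrier_vec p" for x
      using Bb[OF that] B[OF that] by (simp add: y_def)
  qed (use g in auto)
  then have 2: "vnorm (g - P g) \<le> y\<^sup>2" using Hg ng by (simp add: power2_eq_square)
  have "y\<^sup>2 = (vnorm (P g))\<^sup>2 + (vnorm (g - P g))\<^sup>2" using PU.pythagoras[OF g] ng by simp
  also have "\<dots> \<le> k\<^sup>2 + (y\<^sup>2)\<^sup>2" using 1 2 by (intro add_mono power_mono) auto
  finally have q: "y\<^sup>2 \<le> k\<^sup>2 + (y\<^sup>2)\<^sup>2" .
  have k2: "k\<^sup>2 \<le> (5/12 + 1/1000)\<^sup>2" using k0 k1 by (intro power_mono)
  have "y \<le> 12/25"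
  proof (rule ccontr)
    assume "\<not> y \<le> 12/25"
    then have lo: "(12/25)\<^sup>2 \<le> y\<^sup>2" by (intro power_mono) auto
    have hi: "y\<^sup>2 \<le> (3/4)\<^sup>2" using y34 y0 by (intro power_mono)
    have "0 \<le> (y\<^sup>2 - (12/25)\<^sup>2) * ((1 - (12/25)\<^sup>2) - y\<^sup>2)"
      using lo hi by (intro mult_nonneg_nonneg) (auto simp: power2_eq_square)
    then have "(12/25)\<^sup>2 * (1 - (12/25)\<^sup>2) \<le> y\<^sup>2 - (y\<^sup>2)\<^sup>2" by (simp add: algebra_simps power2_eq_square)
    then show False using q k2 by (simp add: power2_eq_square)
  qed
  then have "y * vnorm v \<le> 12/25 * vnorm v" by (intro mult_right_mono) auto
  then show ?thesis using Bb[OF v] B[OF v] by (simp add: y_def)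
qed

lemma H_unit_bound:
  assumes K: "K \<le> (5/12 + 1/1000) * lam" and v: "v \<in> carrier_vec p" "vnorm v \<le> 1" and m: "vnorm (P v) \<le> m"
  shows "vnorm (H v) \<le> 12/25 + m"
proof -
  have "v = P v + (v - P v)" using v PU.vec_carr[OF v(1)] by (intro eq_vecI) auto
  then have "H v = H (P v) + H (v - P v)" using PL.add[of "P v" "v - P v"] v by simp
  then have "vnorm (H v) \<le> vnorm (H (P v)) + vnorm (H (v - P v))" using v by (simp add: vnorm_add_le[of _ p])
  then show ?thesis using PL.contraction[of "P v"] leakage_le[OF K v(1)] v m by simp
qed

text \<open>With \<open>e\<close> the coordinate vector, the entry is \<open>e \<bullet> H E e - e \<bullet> (1 - H) M P e\<close>. In the first term the
projection can be moved to the left factor, and for the diagonal part of the error it yields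
\<open>c (e \<bullet> H e) = c \<parallel>H e\<parallel>\<^sup>2\<close>; the second power of \<open>\<parallel>H e\<parallel>\<close> is what makes the iteration contract.\<close>

lemma diag_error_le:
  assumes K: "K \<le> (5/12 + 1/1000) * lam"
    and i: "i < p" and m: "vnorm (P (unit_vec p i)) \<le> m"
    and W: "W \<in> carrier_mat p p" and EW: "E *\<^sub>v unit_vec p i = W *\<^sub>v unit_vec p i + c \<cdot>\<^sub>v unit_vec p i"
    and Wb: "vnorm (W *\<^sub>v unit_vec p i) \<le> \<delta>" and c: "\<bar>c\<bar> \<le> d"
  shows "\<bar>svd_sum r L s R $$ (i,i) - M $$ (i,i)\<bar> \<le> \<delta> * (12/25 + m) + d * (12/25 + m)\<^sup>2 + 2 * K * m"
proof -
  let ?e = "unit_vec p i :: real vec"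
  have e: "?e \<in> carrier_vec p" by simp
  have "(vnorm ?e)\<^sup>2 = 1" using i by (simp add: vnorm_sq)
  then have ne: "vnorm ?e = 1" using vnorm_nonneg[of ?e] by (simp add: power2_eq_1_iff)
  have entry: "X $$ (i,i) = ?e \<bullet> (X *\<^sub>v ?e)" if "X \<in> carrier_mat p p" for X
    using that i by simp
  have he: "vnorm (H ?e) \<le> 12/25 + m" using H_unit_bound[OF K e _ m] ne by simp
  have m0: "0 \<le> m" using m vnorm_nonneg order.trans by blast
  have d0: "0 \<le> d" using c by linarith
  have We: "W *\<^sub>v ?e \<in> carrier_vec p" using W by simp
  have S: "svd_sum r L s R \<in> carrier_mat p p" by (simp add: svd_sum_def)
  have "svd_sum r L s R $$ (i,i) = ?e \<bullet> H (A *\<^sub>v ?e)" using entry[OF S] H_A_svd[OF e] by simp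
  also have "\<dots> = ?e \<bullet> H (M *\<^sub>v ?e) + H ?e \<bullet> (E *\<^sub>v ?e)"
    by (simp add: A_vec PL.add scalar_prod_add_distrib[of _ p] PL.sym del: scalar_prod_left_unit)
  also have "H ?e \<bullet> (E *\<^sub>v ?e) = H ?e \<bullet> (W *\<^sub>v ?e) + c * (H ?e \<bullet> ?e)"
    unfolding EW using We by (simp add: scalar_prod_add_distrib[of _ p] del: scalar_prod_right_unit)
  also have "H ?e \<bullet> ?e = (vnorm (H ?e))\<^sup>2"
    using PL.sym[of "H ?e" ?e] by (simp add: vnorm_sq PL.idem del: scalar_prod_right_unit)
  finally have S_eq: "svd_sum r L s R $$ (i,i) - M $$ (i,i) =
      H ?e \<bullet> (W *\<^sub>v ?e) + c * (vnorm (H ?e))\<^sup>2 - ?e \<bullet> (M *\<^sub>v ?e - H (M *\<^sub>v ?e))"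
    unfolding entry[OF M_carr] by (simp add: scalar_prod_minus_distrib[of _ p] del: scalar_prod_left_unit)
  have 1: "\<bar>H ?e \<bullet> (W *\<^sub>v ?e)\<bar> \<le> (12/25 + m) * \<delta>"
    using scalar_prod_le_vnorm[OF PL.vec_carr[OF e] We] mult_mono[OF he Wb _ vnorm_nonneg] m0 by linarith
  have 2: "\<bar>c * (vnorm (H ?e))\<^sup>2\<bar> \<le> d * (12/25 + m)\<^sup>2"
    unfolding abs_mult using c d0 he by (intro mult_mono) (auto intro!: power_mono)
  have "\<bar>?e \<bullet> (M *\<^sub>v ?e - H (M *\<^sub>v ?e))\<bar> \<le> vnorm (M *\<^sub>v ?e - H (M *\<^sub>v ?e))"
    using scalar_prod_le_vnorm[OF e, of "M *\<^sub>v ?e - H (M *\<^sub>v ?e)"] ne by (simp del: scalar_prod_left_unit)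
  also have "\<dots> \<le> 2 * K * vnorm (P ?e)"
    using M_minus_H_M[OF PU.vec_carr[OF e]] by (simp add: M_P)
  also have "\<dots> \<le> 2 * K * m" using m K_nonneg by (intro mult_left_mono) auto
  finally have 3: "\<bar>?e \<bullet> (M *\<^sub>v ?e - H (M *\<^sub>v ?e))\<bar> \<le> 2 * K * m" .
  show ?thesis unfolding S_eq using 1 2 3 mult.commute[of \<delta> "12/25 + m"] by linarith
qed

end

section \<open>The sine of the largest principal angle\<close>

lemma orth_complement_first_cols:
  assumes L: "L \<in> orth_frames p p" and rp: "r \<le> p"
  shows "\<exists>W. orth_complement (first_cols r L) W"
proof -
  define W where "W = mat p (p - r) (\<lambda>(i,j). L $$ (i, j + r))"
  have Lc: "L \<in> carrier_mat p p" using L by (auto simp: orth_frames_def)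
  have "W \<in> orth_frames p (p - r)"
    unfolding W_def using orth_frames_cols[OF L] by (intro orth_framesI) auto
  moreover have "(first_cols r L)\<^sup>T * W = 0\<^sub>m r (p - r)"
  proof (rule eq_matI)
    fix i j assume ij: "i < dim_row (0\<^sub>m r (p - r) :: real mat)" "j < dim_col (0\<^sub>m r (p - r) :: real mat)"
    then have "((first_cols r L)\<^sup>T * W) $$ (i,j) = (\<Sum>c<p. L $$ (c,i) * L $$ (c,j + r))"
      using Lc by (auto simp: first_cols_def W_def scalar_prod_def atLeast0LessThan)
    then show "((first_cols r L)\<^sup>T * W) $$ (i,j) = 0\<^sub>m r (p - r) $$ (i,j)"
      using ij orth_frames_cols[OF L, of i "j + r"] by auto
  qed (auto simp: first_cols_def W_def)
  ultimately show ?thesis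
    using Lc by (intro exI[of _ W]) (simp add: orth_complement_def first_cols_def)
qed

text \<open>For every orthogonal complement \<open>W\<close> of the leading columns of \<open>L\<close>, the projection \<open>frame_proj r L\<close> is
annihilated by \<open>W\<^sup>T\<close>, so \<open>W\<^sup>T U a = W\<^sup>T (1 - frame_proj r L) U a\<close>, and \<open>W\<^sup>T\<close> is a contraction.\<close>

lemma sin_theta_norm_le:
  assumes L: "L \<in> orth_frames p p" and U: "U \<in> orth_frames p r" and r: "1 \<le> r"
    and bound: "\<And>v. v \<in> carrier_vec p \<Longrightarrow>
      vnorm (frame_proj r U *\<^sub>v v - frame_proj r L *\<^sub>v (frame_proj r U *\<^sub>v v)) \<le> c * vnorm v"
  shows "sin_theta_norm (first_cols r L) U \<le> c"
proof -
  have rp: "r \<le> p" by (rule orth_frame_dim_le[OF U])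
  have Lc: "L \<in> carrier_mat p p" using L by (auto simp: orth_frames_def)
  have Uc: "U \<in> carrier_mat p r" and UU: "U\<^sup>T * U = 1\<^sub>m r" using U by (auto simp: orth_frames_def)
  define F where "F = first_cols r L"
  have Fc: "F \<in> carrier_mat p r" using Lc by (simp add: F_def first_cols_def)
  define W where "W = (SOME W. orth_complement F W)"
  have "orth_complement F W"
    unfolding W_def F_def by (rule someI_ex[OF orth_complement_first_cols[OF L rp]])
  then have W: "W \<in> orth_frames p (p - r)" and FW: "F\<^sup>T * W = 0\<^sub>m r (p - r)"
    using Fc by (auto simp: orth_complement_def)
  have Wc: "W \<in> carrier_mat p (p - r)" using W by (auto simp: orth_frames_def)
  interpret W: frame_projection p "p - r" "p - r" W using W by unfold_locales auto
  interpret H: frame_projection p p r L using L rp by unfold_locales auto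
  have HF: "frame_proj r L = F * F\<^sup>T"
  proof -
    have "frame_proj r L = frame_proj r F"
      using Lc by (intro eq_matI) (auto simp: frame_proj_def svd_sum_def F_def first_cols_def)
    then show ?thesis using frame_proj_eq[OF Fc] by simp
  qed
  have WT: "vnorm (W\<^sup>T *\<^sub>v x) \<le> vnorm x" if x: "x \<in> carrier_vec p" for x
  proof -
    have "(vnorm (W\<^sup>T *\<^sub>v x))\<^sup>2 = (\<Sum>i<p - r. (col W i \<bullet> x)\<^sup>2)"
      using Wc x by (simp add: vnorm_sq_sum)
    also have "\<dots> = (vnorm (frame_proj (p - r) W *\<^sub>v x))\<^sup>2"
      unfolding frame_proj_def using Wc x by (subst vnorm_svd_sum[OF W]) auto
    finally show ?thesis using W.contraction[OF x] by (simp add: power2_eq_iff_nonneg)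
  qed
  have "W\<^sup>T * F = 0\<^sub>m (p - r) r"
  proof -
    have "W\<^sup>T * F = (F\<^sup>T * W)\<^sup>T" using Fc Wc by (simp add: transpose_mult[of _ r p])
    then show ?thesis unfolding FW by simp
  qed
  then have WH: "W\<^sup>T *\<^sub>v (frame_proj r L *\<^sub>v x) = 0\<^sub>v (p - r)" if x: "x \<in> carrier_vec p" for x
  proof -
    assume WF: "W\<^sup>T * F = 0\<^sub>m (p - r) r"
    have "W\<^sup>T *\<^sub>v (F * F\<^sup>T *\<^sub>v x) = (W\<^sup>T * F) *\<^sub>v (F\<^sup>T *\<^sub>v x)"
      using Wc Fc x by (simp add: assoc_mult_mat_vec[of F p r "F\<^sup>T" p x]
        assoc_mult_mat_vec[of "W\<^sup>T" "p - r" p F r "F\<^sup>T *\<^sub>v x"])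
    also have "\<dots> = 0\<^sub>v (p - r)" unfolding WF using Fc x by (intro eq_vecI) auto
    finally show ?thesis unfolding HF .
  qed
  have "spec_norm (W\<^sup>T * U) \<le> c"
  proof (rule spec_norm_leI)
    show "W\<^sup>T * U \<in> carrier_mat (p - r) r" using Wc Uc by auto
    show "0 < r" using r by simp
    fix a :: "real vec" assume a: "a \<in> carrier_vec r"
    define u where "u = U *\<^sub>v a"
    have u: "u \<in> carrier_vec p" using Uc a by (simp add: u_def)
    have UTu: "U\<^sup>T *\<^sub>v u = a"
      unfolding u_def using Uc a UU by (subst assoc_mult_mat_vec[of _ r p _ r, symmetric]) auto
    have Pu: "frame_proj r U *\<^sub>v u = u"
      unfolding frame_proj_eq[OF Uc] using Uc u by (simp add: assoc_mult_mat_vec[of U p r "U\<^sup>T" p u] UTu) (simp add: u_def)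
    have "(vnorm u)\<^sup>2 = a \<bullet> a"
      using mult_mat_vec_adjoint[OF Uc u a] UTu by (simp add: vnorm_sq u_def)
    then have nu: "vnorm u = vnorm a" unfolding vnorm_sq[symmetric] by (simp add: power2_eq_iff_nonneg)
    have "(W\<^sup>T * U) *\<^sub>v a = W\<^sup>T *\<^sub>v u"
      unfolding u_def using Wc Uc a by (intro assoc_mult_mat_vec[of _ "p - r" p _ r]) auto
    also have "\<dots> = W\<^sup>T *\<^sub>v (u - frame_proj r L *\<^sub>v u)"
      using Wc u H.vec_carr[OF u] WH[OF u] by (subst mult_minus_distrib_mat_vec[of _ "p - r" p]) auto
    finally have "vnorm ((W\<^sup>T * U) *\<^sub>v a) \<le> vnorm (u - frame_proj r L *\<^sub>v u)"
      using WT[of "u - frame_proj r L *\<^sub>v u"] H.vec_carr[OF u] u by simp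
    also have "\<dots> \<le> c * vnorm a" using bound[OF u] Pu nu by simp
    finally show "vnorm ((W\<^sup>T * U) *\<^sub>v a) \<le> c * vnorm a" .
  qed
  then show ?thesis by (simp add: sin_theta_norm_def W_def F_def)
qed

lemma sin_theta_norm_le_1:
  assumes L: "L \<in> orth_frames p p" and U: "U \<in> orth_frames p r" and r: "1 \<le> r"
  shows "sin_theta_norm (first_cols r L) U \<le> 1"
proof (rule sin_theta_norm_le[OF L U r])
  fix v :: "real vec" assume v: "v \<in> carrier_vec p"
  interpret U: frame_projection p r r U using U by unfold_locales auto
  interpret H: frame_projection p p r L using L orth_frame_dim_le[OF U] by unfold_locales auto
  show "vnorm (frame_proj r U *\<^sub>v v - frame_proj r L *\<^sub>v (frame_proj r U *\<^sub>v v)) \<le> 1 * vnorm v"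
    using H.co_contraction[OF U.vec_carr[OF v]] U.contraction[OF v] by simp
qed

section \<open>Contraction of the diagonal error along the iteration\<close>

lemma part_carrier:
  assumes "X \<in> carrier_mat p p"
  shows diag_part_carrier: "diag_part X \<in> carrier_mat p p" and off_diag_carrier: "off_diag X \<in> carrier_mat p p"
  using assms by (auto simp: diag_part_def off_diag_def intro!: minus_carrier_mat)

lemma vnorm_diagonal_le:
  assumes D: "D \<in> carrier_mat p p" "\<And>i. i < p \<Longrightarrow> \<bar>D $$ (i,i)\<bar> \<le> d" and v: "v \<in> carrier_vec p"
    and d: "0 \<le> d"
  shows "vnorm (diag_part D *\<^sub>v v) \<le> d * vnorm v"
proof -
  have "diag_part D *\<^sub>v v = vec p (\<lambda>i. D $$ (i,i) * v $ i)"
    using D v by (intro eq_vecI)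
      (auto simp: diag_part_def scalar_prod_def if_distrib[of "\<lambda>x. x * _"] sum.delta cong: if_cong)
  then have "(vnorm (diag_part D *\<^sub>v v))\<^sup>2 = (\<Sum>i<p. (D $$ (i,i) * v $ i)\<^sup>2)"
    by (simp add: vnorm_sq_sum)
  also have "\<dots> \<le> (\<Sum>i<p. (d * v $ i)\<^sup>2)"
    using D(2) d by (intro sum_mono) (auto simp: abs_le_square_iff[symmetric] abs_mult mult_right_mono)
  also have "\<dots> = (d * vnorm v)\<^sup>2"
    using v by (simp add: power_mult_distrib vnorm_sq_sum sum_distrib_left)
  finally show ?thesis by (rule power2_le_imp_le) (use d in simp)
qed

lemma diag_part_unit:
  assumes "D \<in> carrier_mat p p" "i < p"
  shows "diag_part D *\<^sub>v unit_vec p i = D $$ (i,i) \<cdot>\<^sub>v (unit_vec p i :: real vec)"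
  using assms by (intro eq_vecI) (auto simp: diag_part_def)

lemma incoherent_column_bound:
  assumes U: "U \<in> orth_frames p r" and i: "i < p"
  shows "(vnorm (frame_proj r U *\<^sub>v unit_vec p i))\<^sup>2 = row U i \<bullet> row U i"
proof -
  have Uc: "U \<in> carrier_mat p r" using U by (auto simp: orth_frames_def)
  have "(vnorm (frame_proj r U *\<^sub>v unit_vec p i))\<^sup>2 = (\<Sum>j<r. (U $$ (i,j))\<^sup>2)"
    unfolding frame_proj_def using Uc i by (subst vnorm_svd_sum[OF U]) auto
  also have "\<dots> = row U i \<bullet> row U i" using Uc i by (simp add: scalar_prod_def atLeast0LessThan power2_eq_square)
  finally show ?thesis .
qed

text \<open>The invariant is that the error of the iterate is \<open>\<Delta>(Z)\<close> off the diagonal and at most \<open>d t\<close> on it. The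
sequence \<open>d t = (2/3) \<delta> + 10\<^sup>-\<^sup>6 lam 4\<^sup>-\<^sup>t\<close> solves the recursion \<open>d\<^sub>t\<^sub>+\<^sub>1 = \<delta>/2 + d\<^sub>t/4\<close>. At time \<open>0\<close> the diagonal error is the
diagonal of \<open>M\<close>, which is small since \<open>M\<^sub>i\<^sub>i = P e\<^sub>i \<bullet> M P e\<^sub>i\<close>. The numerical slack between \<open>12/25\<close> and \<open>1/2\<close>
absorbs all terms that contain \<open>m\<close>.\<close>

lemma heteroPCA_sin_theta:
  assumes r: "1 \<le> r" and U: "U \<in> orth_frames p r"
    and M: "M = svd_sum r U \<mu> U" and mu: "\<And>j. j < r \<Longrightarrow> lam \<le> \<bar>\<mu> j\<bar>" and lam: "0 < lam"
    and m: "\<And>i. i < p \<Longrightarrow> vnorm (frame_proj r U *\<^sub>v unit_vec p i) \<le> m"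
    and m_small: "m \<le> 1/1000" "m\<^sup>2 * spec_norm M \<le> lam / 1000000"
    and Z: "Z \<in> carrier_mat p p" and run: "heteroPCA_run (M + Z) r A L s R"
    and \<delta>: "\<delta> = spec_norm (off_diag Z)" and small: "4 * \<delta> < lam"
  shows "sin_theta_norm (first_cols r (L t)) U \<le> 4 * \<delta> / lam + 1 / 2 ^ (t + 3)"
proof -
  define d where "d t = 2/3 * \<delta> + lam / 1000000 / 4 ^ t" for t :: nat
  have rp: "r \<le> p" by (rule orth_frame_dim_le[OF U])
  then have p0: "0 < p" using r by simp
  have Uc: "U \<in> carrier_mat p r" using U by (auto simp: orth_frames_def)
  have Mc: "M \<in> carrier_mat p p" unfolding M using Uc by (auto simp: svd_sum_def)
  have OZ: "off_diag Z \<in> carrier_mat p p" by (rule off_diag_carrier[OF Z])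
  have \<delta>0: "0 \<le> \<delta>" unfolding \<delta> by (rule spec_norm_nonneg[OF OZ p0])
  have d0: "0 \<le> d t" for t using \<delta>0 lam by (simp add: d_def)
  have m0: "0 \<le> m" using m[OF p0] vnorm_nonneg order.trans by blast
  have A0: "A 0 = off_diag (M + Z)" and svd: "\<And>t. is_svd p (A t) (L t) (s t) (R t)"
    and step: "\<And>t. A (Suc t) = diag_part (svd_sum r (L t) (s t) (R t)) + off_diag (A t)"
    using run Mc Z by (auto simp: heteroPCA_run_def)
  have LR: "L t \<in> carrier_mat p p" "R t \<in> carrier_mat p p" for t
    using svd[of t] by (auto simp: is_svd_def orth_frames_def)
  define invariant where "invariant t \<longleftrightarrow> A t \<in> carrier_mat p p \<and> off_diag (A t - M) = off_diag Z \<and>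
      (\<forall>i<p. \<bar>(A t - M) $$ (i,i)\<bar> \<le> d t)" for t
  have K_small: "\<delta> + d t \<le> (5/12 + 1/1000) * lam" for t
  proof -
    have "lam / 1000000 / 4 ^ t \<le> lam / 1000000" using lam by (simp add: divide_le_eq mult_le_cancel_left1)
    then show ?thesis using small lam unfolding d_def by simp
  qed
  have split: "(A t - M) *\<^sub>v v = off_diag Z *\<^sub>v v + diag_part (A t - M) *\<^sub>v v"
    if "invariant t" "v \<in> carrier_vec p" for t v
  proof -
    have c: "A t - M \<in> carrier_mat p p" using that Mc by (auto simp: invariant_def)
    have "A t - M = off_diag (A t - M) + diag_part (A t - M)"
      using c by (intro eq_matI) (auto simp: off_diag_def diag_part_def)
    then have "A t - M = off_diag Z + diag_part (A t - M)" using that by (simp add: invariant_def)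
    moreover have "(off_diag Z + diag_part (A t - M)) *\<^sub>v v = off_diag Z *\<^sub>v v + diag_part (A t - M) *\<^sub>v v"
      by (rule add_mult_distrib_mat_vec[of _ p p]) (use OZ diag_part_carrier[OF c] that in auto)
    ultimately show ?thesis by metis
  qed
  have pert: "perturbed_svd p r U M (A t - M) (A t) (L t) (R t) \<mu> (s t) lam (\<delta> + d t)" if I: "invariant t" for t
  proof
    have c: "A t \<in> carrier_mat p p" using I by (simp add: invariant_def)
    then show "A t - M \<in> carrier_mat p p" using Mc by auto
    then have c': "A t - M \<in> carrier_mat p p" .
    show "A t = M + (A t - M)" using c Mc by (intro eq_matI) auto
    fix v :: "real vec" assume v: "v \<in> carrier_vec p"
    have Dc: "diag_part (A t - M) \<in> carrier_mat p p" by (rule diag_part_carrier[OF c'])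
    have "vnorm ((A t - M) *\<^sub>v v) \<le> vnorm (off_diag Z *\<^sub>v v) + vnorm (diag_part (A t - M) *\<^sub>v v)"
      unfolding split[OF I v] using OZ Dc v by (intro vnorm_add_le[of _ p]) auto
    also have "\<dots> \<le> \<delta> * vnorm v + d t * vnorm v"
      using vnorm_mult_le_spec_norm[OF OZ p0 v] vnorm_diagonal_le[OF c' _ v d0] I
      by (auto simp: \<delta> invariant_def intro!: add_mono)
    finally show "vnorm ((A t - M) *\<^sub>v v) \<le> (\<delta> + d t) * vnorm v" by (simp add: distrib_right)
  qed (use r U M mu lam svd in auto)
  have "invariant t" for t
  proof (induction t)
    case 0
    have c: "A 0 \<in> carrier_mat p p" unfolding A0 by (rule off_diag_carrier[OF add_carrier_mat[OF Z]])
    have "off_diag (A 0 - M) = off_diag Z"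
      unfolding A0 using Mc Z by (intro eq_matI) (auto simp: off_diag_def diag_part_def)
    moreover have "\<bar>(A 0 - M) $$ (i,i)\<bar> \<le> d 0" if i: "i < p" for i
    proof -
      let ?e = "unit_vec p i :: real vec"
      interpret PU: frame_projection p r r U using U by unfold_locales auto
      let ?u = "frame_proj r U *\<^sub>v ?e"
      have u: "?u \<in> carrier_vec p" by simp
      have MP: "M *\<^sub>v ?u = M *\<^sub>v ?e" and PM: "frame_proj r U *\<^sub>v (M *\<^sub>v ?u) = M *\<^sub>v ?u"
        unfolding M frame_proj_def using Uc by (simp_all add: svd_sum_mult_vec[OF U])
      have "M $$ (i,i) = ?e \<bullet> (M *\<^sub>v ?e)" using Mc i by simp
      also have "\<dots> = ?e \<bullet> (frame_proj r U *\<^sub>v (M *\<^sub>v ?u))" by (simp only: PM) (simp only: MP)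
      also have "\<dots> = ?u \<bullet> (M *\<^sub>v ?u)"
        by (rule PU.sym) (use mult_mat_vec_carrier[OF Mc u] in auto)
      finally have "\<bar>M $$ (i,i)\<bar> \<le> vnorm ?u * vnorm (M *\<^sub>v ?u)"
        using scalar_prod_le_vnorm[OF u mult_mat_vec_carrier[OF Mc u]] by simp
      also have "\<dots> \<le> vnorm ?u * (spec_norm M * vnorm ?u)"
        by (intro mult_left_mono vnorm_mult_le_spec_norm[OF Mc p0 u]) simp
      also have "\<dots> = (vnorm ?u)\<^sup>2 * spec_norm M" by (simp add: power2_eq_square)
      also have "\<dots> \<le> m\<^sup>2 * spec_norm M"
        using m[OF i] spec_norm_nonneg[OF Mc p0] by (intro mult_right_mono power_mono) auto
      also have "\<dots> \<le> d 0" using m_small \<delta>0 by (simp add: d_def)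
      finally show ?thesis unfolding A0 using Mc Z i by (simp add: off_diag_def diag_part_def)
    qed
    ultimately show ?case using c by (simp add: invariant_def)
  next
    case (Suc t)
    interpret perturbed_svd p r U M "A t - M" "A t" "L t" "R t" \<mu> "s t" lam "\<delta> + d t"
      by (rule pert[OF Suc])
    have c: "A t \<in> carrier_mat p p" and c': "A t - M \<in> carrier_mat p p" using Suc Mc by (auto simp: invariant_def)
    have S: "svd_sum r (L t) (s t) (R t) \<in> carrier_mat p p" using LR[of t] by (auto simp: svd_sum_def)
    have cS: "A (Suc t) \<in> carrier_mat p p" unfolding step by (rule add_carrier_mat[OF off_diag_carrier[OF c]])
    have off: "A (Suc t) $$ (i,j) = A t $$ (i,j)" if "i < p" "j < p" "i \<noteq> j" for i j
      unfolding step using that c S by (simp add: diag_part_def off_diag_def)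
    have diag: "A (Suc t) $$ (i,i) = svd_sum r (L t) (s t) (R t) $$ (i,i)" if "i < p" for i
      unfolding step using that c S by (simp add: diag_part_def off_diag_def)
    have "off_diag (A (Suc t) - M) = off_diag (A t - M)"
      using off c cS Mc by (intro eq_matI) (auto simp: off_diag_def diag_part_def)
    moreover have "\<bar>(A (Suc t) - M) $$ (i,i)\<bar> \<le> d (Suc t)" if i: "i < p" for i
    proof -
      have "(A t - M) *\<^sub>v unit_vec p i = off_diag Z *\<^sub>v unit_vec p i + (A t - M) $$ (i,i) \<cdot>\<^sub>v unit_vec p i"
        unfolding split[OF Suc unit_vec_carrier] diag_part_unit[OF c' i] ..
      moreover have "vnorm (off_diag Z *\<^sub>v unit_vec p i) \<le> \<delta>"
      proof -
        have "(vnorm (unit_vec p i))\<^sup>2 = 1" using i by (simp add: vnorm_sq)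
        then have "vnorm (unit_vec p i) = 1" using vnorm_nonneg[of "unit_vec p i"] by (simp add: power2_eq_1_iff)
        then show ?thesis using vnorm_mult_le_spec_norm[OF OZ p0, of "unit_vec p i"] by (simp add: \<delta>)
      qed
      moreover have "\<bar>(A t - M) $$ (i,i)\<bar> \<le> d t" using Suc i by (simp add: invariant_def)
      ultimately have "\<bar>svd_sum r (L t) (s t) (R t) $$ (i,i) - M $$ (i,i)\<bar>
          \<le> \<delta> * (12/25 + m) + d t * (12/25 + m)\<^sup>2 + 2 * (\<delta> + d t) * m"
        using diag_error_le[OF K_small i m[OF i] OZ] by blast
      also have "\<dots> = \<delta> * (12/25 + 3 * m) + d t * ((12/25 + m)\<^sup>2 + 2 * m)" by (simp add: algebra_simps)
      also have "\<dots> \<le> \<delta> * (1/2) + d t * (1/4)"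
      proof (intro add_mono mult_left_mono \<delta>0 d0)
        have "(12/25 + m)\<^sup>2 \<le> (12/25 + 1/1000)\<^sup>2" using m_small m0 by (intro power_mono) auto
        then show "(12/25 + m)\<^sup>2 + 2 * m \<le> 1/4" using m_small by (simp add: power2_eq_square)
      qed (use m_small in simp)
      also have "\<dots> = d (Suc t)" by (simp add: d_def field_simps)
      finally show ?thesis using diag[OF i] cS Mc i by simp
    qed
    ultimately show ?case using Suc cS by (simp add: invariant_def)
  qed
  then interpret perturbed_svd p r U M "A t - M" "A t" "L t" "R t" \<mu> "s t" lam "\<delta> + d t"
    by (rule pert)
  have "sin_theta_norm (first_cols r (L t)) U \<le> 2 * (\<delta> + d t) / lam"
    by (rule sin_theta_norm_le[OF L U r sin_theta_le])
  also have "\<dots> = 10/3 * (\<delta> / lam) + 2 / 1000000 * (1 / 4 ^ t)" using lam by (simp add: d_def field_simps)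
  also have "\<dots> \<le> 4 * (\<delta> / lam) + 1/8 * (1 / 2 ^ t)"
  proof (intro add_mono mult_mono)
    show "1 / 4 ^ t \<le> 1 / (2::real) ^ t" by (intro frac_le power_mono) auto
  qed (use \<delta>0 lam in auto)
  also have "\<dots> = 4 * \<delta> / lam + 1 / 2 ^ (t + 3)" by (simp add: power_add)
  finally show ?thesis .
qed

section \<open>The error bound for HeteroPCA\<close>

text \<open>Dividing the incoherence assumption by \<open>p/r\<close> bounds the largest squared row norm \<open>B\<close> of \<open>U\<close> by
\<open>10\<^sup>-\<^sup>6 \<lambda> / \<parallel>M\<parallel>\<close>, and \<open>\<lambda> \<le> \<parallel>M\<parallel>\<close> turns this into \<open>B \<le> 10\<^sup>-\<^sup>6\<close>. The constant \<open>2\<close> for the number of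
iterations is enough because \<open>ln 2 \<ge> 1/2\<close>.\<close>

theorem theorem3:
  shows "\<exists>cI>0. \<exists>C1>0. \<exists>C>0.
    \<forall>(p::nat) (r::nat) (M::real mat) (U::real mat) (Z::real mat) (N::real mat)
      (A::nat \<Rightarrow> real mat) (L::nat \<Rightarrow> real mat) (s::nat \<Rightarrow> nat \<Rightarrow> real) (R::nat \<Rightarrow> real mat).
      1 \<le> r \<longrightarrow>
      M \<in> carrier_mat p p \<longrightarrow> transpose_mat M = M \<longrightarrow> vec_space.rank p M = r \<longrightarrow>
      U \<in> orth_frames p r \<longrightarrow> (\<forall>j<r. \<exists>\<mu>. \<mu> \<noteq> 0 \<and> eigenvector M (col U j) \<mu>) \<longrightarrow>
      Z \<in> carrier_mat p p \<longrightarrow> transpose_mat Z = Z \<longrightarrow>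
      N = M + Z \<longrightarrow>
      heteroPCA_run N r A L s R \<longrightarrow>
      incoherence U * spec_norm M / sing_val r M \<le> cI * (real p / real r) \<longrightarrow>
      (\<forall>t. sin_theta_norm (first_cols r (L t)) U
             \<le> 4 * spec_norm (off_diag Z) / sing_val r M + 1 / 2 ^ (t + 3)) \<and>
      (\<forall>T::nat. spec_norm (off_diag Z) > 0 \<longrightarrow>
             real T \<ge> C1 * max (ln (sing_val r M / spec_norm (off_diag Z))) 1 \<longrightarrow>
             sin_theta_norm (first_cols r (L T)) U
               \<le> C * min (spec_norm (off_diag Z) / sing_val r M) 1)"
proof (intro exI conjI allI impI)
  show "(0::real) < 1/1000000" "(0::real) < 2" "(0::real) < 5" by simp_all
next
  fix p r :: nat and M U Z N :: "real mat" and A L R :: "nat \<Rightarrow> real mat" and s :: "nat \<Rightarrow> nat \<Rightarrow> real"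
  assume r: "1 \<le> r" and Mc: "M \<in> carrier_mat p p" and Msym: "M\<^sup>T = M" and rk: "vec_space.rank p M = r"
    and U: "U \<in> orth_frames p r" and ev: "\<forall>j<r. \<exists>\<mu>. \<mu> \<noteq> 0 \<and> eigenvector M (col U j) \<mu>"
    and Z: "Z \<in> carrier_mat p p" and N: "N = M + Z" and run: "heteroPCA_run N r A L s R"
    and inc: "incoherence U * spec_norm M / sing_val r M \<le> 1/1000000 * (real p / real r)"
  have rp: "r \<le> p" by (rule orth_frame_dim_le[OF U])
  then have p0: "0 < p" using r by simp
  have Uc: "U \<in> carrier_mat p r" using U by (auto simp: orth_frames_def)
  obtain \<mu> where mu0: "\<And>j. j < r \<Longrightarrow> \<mu> j \<noteq> 0" and mu: "\<And>j. j < r \<Longrightarrow> M *\<^sub>v col U j = \<mu> j \<cdot>\<^sub>v col U j"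
    using ev unfolding eigenvector_def by metis
  obtain Q where Q: "Q \<in> orth_frames p p" "\<And>i j. i < p \<Longrightarrow> j < r \<Longrightarrow> Q $$ (i,j) = U $$ (i,j)"
    using orth_frame_extend[OF U] by blast
  have Qc: "Q \<in> carrier_mat p p" using Q by (auto simp: orth_frames_def)
  have MQ: "M = svd_sum p Q (\<lambda>i. if i < r then \<mu> i else 0) Q"
    by (rule eigenvectors_svd_sum[OF Mc Msym rk U mu mu0 Q])
  have M: "M = svd_sum r U \<mu> U"
  proof (rule eq_matI)
    fix a b assume "a < dim_row (svd_sum r U \<mu> U)" "b < dim_col (svd_sum r U \<mu> U)"
    then have ab: "a < p" "b < p" using Uc by (auto simp: svd_sum_def)
    have "M $$ (a,b) = (\<Sum>i<p. if i < r then \<mu> i * Q $$ (a,i) * Q $$ (b,i) else 0)"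
      using ab Qc by (subst MQ) (auto simp: svd_sum_def intro!: sum.cong)
    also have "\<dots> = (\<Sum>i<r. \<mu> i * U $$ (a,i) * U $$ (b,i))"
      using rp ab Q(2) by (subst sum.inter_filter[symmetric]) (auto intro!: sum.cong)
    finally show "M $$ (a,b) = svd_sum r U \<mu> U $$ (a,b)" using ab Uc by (simp add: svd_sum_def)
  qed (use Mc Uc in \<open>auto simp: svd_sum_def\<close>)
  define lam where "lam = sing_val r M"
  have lam_Min: "lam = Min ((\<lambda>i. \<bar>\<mu> i\<bar>) ` {..<r})"
    unfolding lam_def by (subst MQ) (rule sing_val_rank[OF Q(1) r rp])
  have ne: "(\<lambda>i. \<bar>\<mu> i\<bar>) ` {..<r} \<noteq> {}" using r by (auto simp: lessThan_empty_iff)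
  have lam0: "0 < lam" unfolding lam_Min using mu0 ne by (subst Min_gr_iff) auto
  have lam_le: "lam \<le> \<bar>\<mu> j\<bar>" if "j < r" for j unfolding lam_Min using that by (intro Min_le) auto
  define \<delta> where "\<delta> = spec_norm (off_diag Z)"
  define B where "B = Max ((\<lambda>i. row U i \<bullet> row U i) ` {..<p})"
  have B_ge: "row U i \<bullet> row U i \<le> B" if "i < p" for i unfolding B_def using that by (intro Max_ge) auto
  have "0 \<le> row U 0 \<bullet> row U 0" using vnorm_sq[of "row U 0"] by (metis zero_le_power2)
  then have B0: "0 \<le> B" using B_ge[OF p0] by linarith
  have pr: "0 < real p / real r" using p0 r by simp
  have "real p / real r * (B * spec_norm M / lam) \<le> real p / real r * (1/1000000)"
    using inc Uc by (simp add: incoherence_def B_def lam_def mult_ac)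
  then have "B * spec_norm M / lam \<le> 1/1000000" using pr by (simp only: mult_le_cancel_left_pos)
  then have BM: "B * spec_norm M \<le> lam / 1000000" using lam0 by (simp add: divide_le_eq)
  have "lam \<le> spec_norm M"
  proof -
    have c: "col U 0 \<in> carrier_vec p" using Uc r by auto
    have "col U 0 \<bullet> col U 0 = 1"
      using orth_frames_cols[OF U, of 0 0] r Uc by (simp add: scalar_prod_def atLeast0LessThan)
    then have "vnorm (col U 0) = 1" using vnorm_sq[of "col U 0"] vnorm_nonneg[of "col U 0"] by (simp add: power2_eq_1_iff)
    then show ?thesis
      using vnorm_mult_le_spec_norm[OF Mc p0 c] mu[of 0] lam_le[of 0] r by (simp add: vnorm_smult)
  qed
  then have "B * lam \<le> lam / 1000000" using BM B0 mult_left_mono[of lam "spec_norm M" B] by linarith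
  then have B_small: "B \<le> 1/1000000" using lam0 by (simp add: field_simps)
  have m: "vnorm (frame_proj r U *\<^sub>v unit_vec p i) \<le> sqrt B" if "i < p" for i
    using B_ge[OF that] incoherent_column_bound[OF U that] by (simp add: real_le_rsqrt)
  have "sqrt B \<le> sqrt ((1/1000)\<^sup>2)" using B_small by (intro real_sqrt_le_mono) (simp add: power2_eq_square)
  then have m1: "sqrt B \<le> 1/1000" by simp
  have m2: "(sqrt B)\<^sup>2 * spec_norm M \<le> lam / 1000000" using BM B0 by simp
  have Lt: "L t \<in> orth_frames p p" for t
    using run Mc Z N by (auto simp: heteroPCA_run_def is_svd_def)
  have le1: "sin_theta_norm (first_cols r (L t)) U \<le> 1" for t
    by (rule sin_theta_norm_le_1[OF Lt U r])
  have main: "sin_theta_norm (first_cols r (L t)) U \<le> 4 * \<delta> / lam + 1 / 2 ^ (t + 3)" for t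
  proof (cases "4 * \<delta> < lam")
    case True
    then show ?thesis
      using heteroPCA_sin_theta[OF r U M lam_le lam0 m m1 m2 Z run[unfolded N] \<delta>_def] by blast
  next
    case False
    then have "1 \<le> 4 * \<delta> / lam" using lam0 by simp
    moreover have "(0::real) \<le> 1 / 2 ^ (t + 3)" by simp
    ultimately show ?thesis using le1[of t] by linarith
  qed
  show "sin_theta_norm (first_cols r (L t)) U
          \<le> 4 * spec_norm (off_diag Z) / sing_val r M + 1 / 2 ^ (t + 3)" for t
    using main by (simp add: \<delta>_def lam_def)
  fix T :: nat
  assume d0: "0 < spec_norm (off_diag Z)"
    and T: "2 * max (ln (sing_val r M / spec_norm (off_diag Z))) 1 \<le> real T"
  have \<delta>0: "0 < \<delta>" using d0 by (simp add: \<delta>_def)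
  have "ln (lam / \<delta>) \<le> real T / 2" using T by (simp add: \<delta>_def lam_def)
  also have "\<dots> \<le> real T * ln 2"
  proof -
    have "1 / 2 \<le> ln (2::real)" using ln_le_minus_one[of "1/2 :: real"] by (simp add: ln_div)
    then have "real T * (1 / 2) \<le> real T * ln 2" by (rule mult_left_mono) simp
    then show ?thesis by simp
  qed
  also have "\<dots> = ln (2 ^ T)" by (simp add: ln_realpow)
  finally have "lam / \<delta> \<le> 2 ^ T" using lam0 \<delta>0 by (subst (asm) ln_le_cancel_iff) auto
  then have "1 / 2 ^ T \<le> \<delta> / lam" using lam0 \<delta>0 by (simp add: field_simps)
  then have "1 / 2 ^ (T + 3) \<le> \<delta> / lam" using lam0 \<delta>0 by (simp add: power_add field_simps)
  then have "sin_theta_norm (first_cols r (L T)) U \<le> 5 * (\<delta> / lam)" using main[of T] by simp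
  moreover have "sin_theta_norm (first_cols r (L T)) U \<le> 5 * 1" using le1[of T] by simp
  ultimately show "sin_theta_norm (first_cols r (L T)) U
               \<le> 5 * min (spec_norm (off_diag Z) / sing_val r M) 1"
    by (simp add: \<delta>_def lam_def min_def)
qed

end
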